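(* Let $m$ be a negative integer, $M$ a positive integer, $0\le m_2\le-m$ an integer, and let $\Lambda=\Lambda^{[m;m_2]J}_{k_1,k_2}$ be a principal admissible weight with $J=\mathrm I$ or $\mathrm{III}$. Then, up to a sign, the modified supercharacters ($\epsilon=0$) and characters ($\epsilon=\frac12$) of the quantum Hamiltonian reductions of $L(\Lambda)$ and $L^{\mathrm{tw}}(\Lambda)$ are given by $$\widetilde{\mathrm{ch}}^{(\epsilon)}_{H(\Lambda)}(\tau,z)=\chi^{(1)[M,-m;\epsilon]}_{j,k;\frac12}(\tau,z)-\Big(\frac{m(j-k)}M+m_2\Big)\chi^{(0)[M,-m;\epsilon]}_{j,k;\frac12}(\tau,z),$$ where $(j,k)=(k_1+\frac12,-k_1-k_2-\frac12)$ for $J=\mathrm I$ and $(j,k)=(k_1+k_2+\frac12,-k_1-\frac12)$ for $J=\mathrm{III}$; and $$\widetilde{\mathrm{ch}}^{(\epsilon)}_{H^{\mathrm{tw}}(\Lambda)}(\tau,z)=\chi^{(1)[M,-m;\epsilon]}_{j,k;0}(\tau,z)-\Big(\frac{m(j-k)}M+m_2\Big)\chi^{(0)[M,-m;\epsilon]}_{j,k;0}(\tau,z),$$ where $(j,k)=(k_1+k_2+1,-k_1)$ for $J=\mathrm I$ and $(j,k)=(k_1+1,-k_1-k_2)$ for $J=\mathrm{III}$.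
   Context: Throughout $\operatorname{Im}\tau>0$, $q=e^{2\pi i\tau}$, $\epsilon,\epsilon'\in\{0,\frac12\}$. Functions. For a positive integer $\ell$: $\Theta_{j,\ell}(\tau,z)=\sum_{r\in\mathbb Z+\frac{j}{2\ell}}q^{\ell r^2}e^{2\pi i\ell rz}$; $\Phi_1^{[\ell;0]}(\tau,z_1,z_2)=\sum_{j\in\mathbb Z}\frac{e^{2\pi i\ell j(z_1+z_2)}q^{j^2\ell}}{1-e^{2\pi iz_1}q^j}$; $\Phi^{[\ell;0]}(\tau,z_1,z_2)=\Phi_1^{[\ell;0]}(\tau,z_1,z_2)-\Phi_1^{[\ell;0]}(\tau,-z_2,-z_1)$; $E(x)=2\int_0^xe^{-\pi u^2}du$; $R_{j;\ell}(\tau,v)=\sum_{r\in\mathbb Z,\ r\equiv j\,(2\ell)}\big(\mathrm{sgn}(r-\tfrac12-j+2\ell)-E((r-2\ell\tfrac{\operatorname{Im}v}{\operatorname{Im}\tau})\sqrt{\tfrac{\operatorname{Im}\tau}{\ell}})\big)e^{-\frac{\pi ir^2}{2\ell}\tau+2\pi irv}$; $\tilde\Phi^{[\ell;0]}(\tau,z_1,z_2)=\Phi^{[\ell;0]}(\tau,z_1,z_2)+\frac12\sum_{j=0}^{2\ell-1}R_{j;\ell}(\tau,\tfrac{z_1-z_2}2)(\Theta_{-j,\ell}-\Theta_{j,\ell})(\tau,z_1+z_2)$. With $D_0=\frac1{2\pi i}(\frac{\partial}{\partial z_1}-\frac{\partial}{\partial z_2})$ and $j,k\in\epsilon'+\mathbb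 Z$: $\tilde\Psi^{[M,-m;0;\epsilon]}_{j,k;\epsilon'}(\tau,z_1,z_2)=q^{-\frac{m}Mjk}e^{-\frac{2\pi im}M(kz_1+jz_2)}\tilde\Phi^{[-m;0]}(M\tau,z_1+j\tau+\epsilon,z_2+k\tau+\epsilon)$, $P^{[M,-m;\epsilon]}_{j,k;\epsilon'}(\tau,z_1,z_2)=\big(D_0+\frac{m(z_1-z_2)}{2M\tau}\big)\tilde\Psi^{[M,-m;0;\epsilon]}_{j,k;\epsilon'}(\tau,z_1,z_2)$. With $\vartheta_{00}=\Theta_{2,2}+\Theta_{0,2}$, $\vartheta_{01}=-\Theta_{2,2}+\Theta_{0,2}$, $\vartheta_{10}=\Theta_{1,2}+\Theta_{-1,2}$, $\vartheta_{11}=i\Theta_{1,2}-i\Theta_{-1,2}$ and the Dedekind $\eta$, put $R^{(\epsilon)}_{\epsilon'}(\tau,z)=\eta(\tau)^3\frac{\vartheta_{11}(\tau,2z)}{\vartheta_{1-2\epsilon',1-2\epsilon}(\tau,z)^2}$ and $$\chi^{(1)[M,-m;\epsilon]}_{j,k;\epsilon'}(\tau,z)=\frac{P^{[M,-m;\epsilon]}_{j,k;\epsilon'}(\tau,z,z)}{R^{(\epsilon)}_{\epsilon'}(\tau,z)},\qquad \chi^{(0)[M,-m;\epsilon]}_{j,k;\epsilon'}(\tau,z)=\frac{\tilde\Psi^{[M,-m;0;\epsilon]}_{j,k;\epsilon'}(\tau,z,z)}{R^{(\epsilon)}_{\epsilon'}(\tau,z)}.$$ Weights. $\mathfrak g=ps\ell_{2|2}$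 with simple roots $\alpha_1,\alpha_2,\alpha_3$; $(\alpha_1|\alpha_1)=(\alpha_3|\alpha_3)=(\alpha_1|\alpha_3)=0$, $(\alpha_2|\alpha_2)=-2$, $(\alpha_1|\alpha_2)=(\alpha_2|\alpha_3)=1$, $\theta=\alpha_1+\alpha_2+\alpha_3$, $h^\vee=0$, $\rho=-\frac12(\alpha_1+\alpha_3)$. $\Lambda^{[m;m_2]}=m\Lambda_0-\frac{m_2}2(\alpha_1+\alpha_3)$, and with $K=\frac mM$, $\Lambda^{[m;m_2]J}_{k_1,k_2}=t_\beta y(\Lambda^{[m;m_2]}-(M-1)K\Lambda_0+\rho)-\rho$, where $y=1$, $\beta=-\frac{2k_1+k_2}2(\alpha_1+\alpha_3)-k_1\alpha_2$ and $k_1,k_2\ge0$, $2k_1+k_2\le M-1$ for $J=\mathrm I$; $y=r_{\alpha_2}$, $\beta=-\frac{2k_1+k_2}2(\alpha_1+\alpha_3)-(k_1+k_2)\alpha_2$ and $k_1\ge0$, $k_2\ge1$, $2k_1+k_2\le M-1$ for $J=\mathrm{III}$ ($k_1,k_2$ integers). One has $(\Lambda|\alpha_2)=-Kk_2-m_2$ for $J=\mathrm I$ and $(\Lambda|\alpha_2)=Kk_2+m_2+2$ for $J=\mathrm{III}$. Modified (super)characters. $H(\Lambda)$, $H^{\mathrm{tw}}(\Lambda)$ are the Neveu–Schwarz and Ramond type modules over the $N=4$ superconformal algebra $W^K(\mathfrak g,e_{-\theta})$ obtained from $L(\Lambda)$ and its twist $L^{\mathrm{tw}}(\Lambda)$ by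 $w_0=r_{\alpha_2}t_{\frac12\alpha_2}$. Their modified (super)characters are defined as follows. Put $N_{\mathrm I}(\tau,z_1,z_2,t)=e^{\frac{2\pi im}M t}e^{\frac{2\pi im}M((k_1+k_2)z_1-k_1z_2)}q^{\frac mMk_1(k_1+k_2)}\big((D_0-m_2)\tilde\Phi^{[-m;0]}\big)(M\tau,z_1+k_1\tau,z_2-(k_1+k_2)\tau)$ and $N_{\mathrm{III}}(\tau,z_1,z_2,t)=N_{\mathrm I}(\tau,-z_2,-z_1,t)$ (the modified numerators of the normalized supercharacter of $L(\Lambda)$). For $N^-_\Lambda=N_J$ put $N^+_\Lambda(\tau,z_1,z_2,t)=-e^{\pi i(\Lambda|\alpha_2)}N^-_\Lambda(\tau,z_1+\frac12,z_2+\frac12,t)$ and $N^{\pm,\mathrm{tw}}_\Lambda(\tau,z_1,z_2,t)=N^\pm_\Lambda(\tau,-z_2-\frac\tau2,-z_1-\frac\tau2,t-\frac{z_1+z_2}2-\frac\tau4)$. Then, with $+$ for $\epsilon=\frac12$ and $-$ for $\epsilon=0$, $\widetilde{\mathrm{ch}}^{(\epsilon)}_{H(\Lambda)}(\tau,z)=N^\pm_\Lambda(\tau,z+\frac\tau2,z-\frac\tau2,\frac\tau4)/R^{(\epsilon)}_{\frac12}(\tau,z)$ and $\widetilde{\mathrm{ch}}^{(\epsilon)}_{H^{\mathrm{tw}}(\Lambda)}(\tau,z)=N^{\pm,\mathrm{tw}}_\Lambda(\tau,z+\frac\tau2,z-\frac\tau2,\frac\tau4)/R^{(\epsilon)}_0(\tau,z)$.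 *)

theory Defs
  imports "HOL-Analysis.Analysis"
begin

section \<open>Theta functions and Appell functions\<close>

text \<open>\<^term>\<open>qpow \<tau> x\<close> is $q^x$ with $q = e^{2\pi i\tau}$, taken with the branch $e^{2\pi i\tau x}$.\<close>

definition qpow :: "complex \<Rightarrow> complex \<Rightarrow> complex" where
  "qpow \<tau> x = exp (2 * pi * \<i> * \<tau> * x)"

text \<open>The summation index is $r = n + j/(2\ell)$ with $n$ an integer.\<close>

definition Theta :: "int \<Rightarrow> int \<Rightarrow> complex \<Rightarrow> complex \<Rightarrow> complex" where
  "Theta j l \<tau> z =
     (\<Sum>\<^sub>\<infinity>n::int. let r = of_int n + of_int j / (2 * of_int l) in
        qpow \<tau> (of_int l * r\<^sup>2) * exp (2 * pi * \<i> * of_int l * r * z))"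

definition Phi1 :: "int \<Rightarrow> complex \<Rightarrow> complex \<Rightarrow> complex \<Rightarrow> complex" where
  "Phi1 l \<tau> z1 z2 =
     (\<Sum>\<^sub>\<infinity>j::int. exp (2 * pi * \<i> * of_int l * of_int j * (z1 + z2)) * qpow \<tau> (of_int j ^ 2 * of_int l)
        / (1 - exp (2 * pi * \<i> * z1) * qpow \<tau> (of_int j)))"

definition Phi :: "int \<Rightarrow> complex \<Rightarrow> complex \<Rightarrow> complex \<Rightarrow> complex" where
  "Phi l \<tau> z1 z2 = Phi1 l \<tau> z1 z2 - Phi1 l \<tau> (- z2) (- z1)"

text \<open>The integral is oriented, so that \<open>E\<close> is odd.\<close>

definition E :: "real \<Rightarrow> real" where
  "E x = 2 * (LBINT u=0..x. exp (- pi * u\<^sup>2))"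

definition Rcorr :: "int \<Rightarrow> int \<Rightarrow> complex \<Rightarrow> complex \<Rightarrow> complex" where
  "Rcorr j l \<tau> v =
     (\<Sum>\<^sub>\<infinity>r\<in>{r::int. r mod (2 * l) = j mod (2 * l)}.
        complex_of_real
          (sgn (of_int r - 1/2 - of_int j + 2 * of_int l)
           - E ((of_int r - 2 * of_int l * (Im v / Im \<tau>)) * sqrt (Im \<tau> / of_int l)))
        * exp (- (pi * \<i> * of_int r ^ 2 / (2 * of_int l)) * \<tau> + 2 * pi * \<i> * of_int r * v))"

definition Phit :: "int \<Rightarrow> complex \<Rightarrow> complex \<Rightarrow> complex \<Rightarrow> complex" where
  "Phit l \<tau> z1 z2 = Phi l \<tau> z1 z2 +
     1/2 * (\<Sum>j\<in>{0..2 * l - 1}.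
       Rcorr j l \<tau> ((z1 - z2) / 2) * (Theta (- j) l \<tau> (z1 + z2) - Theta j l \<tau> (z1 + z2)))"

text \<open>\<^const>\<open>Phit\<close> is real analytic but not holomorphic in $z_1, z_2$, because \<^const>\<open>Rcorr\<close> involves
  $\mathrm{Im}\,v$.  Hence $\partial/\partial z$ is the Wirtinger derivative
  $\frac12(\partial/\partial x - i\,\partial/\partial y)$, $z = x + iy$.\<close>

definition wirtinger :: "(complex \<Rightarrow> complex) \<Rightarrow> complex \<Rightarrow> complex" where
  "wirtinger f z =
     (vector_derivative (\<lambda>x::real. f (z + of_real x)) (at 0)
      - \<i> * vector_derivative (\<lambda>y::real. f (z + \<i> * of_real y)) (at 0)) / 2"

definition D0 :: "(complex \<Rightarrow> complex \<Rightarrow> complex) \<Rightarrow> complex \<Rightarrow> complex \<Rightarrow> complex" where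
  "D0 F z1 z2 = 1 / (2 * pi * \<i>) * (wirtinger (\<lambda>w. F w z2) z1 - wirtinger (\<lambda>w. F z1 w) z2)"

section \<open>The functions $\tilde\Psi$, $P$ and $\chi$\<close>

text \<open>The arguments \<open>M m\<close> stand for the superscript $[M,-m]$.  The subscript $\epsilon'$ of
  $\tilde\Psi$ and $P$ only records that $j, k \in \epsilon' + \mathbb{Z}$; it does not enter the
  formulas and is omitted.\<close>

definition Psit :: "int \<Rightarrow> int \<Rightarrow> real \<Rightarrow> real \<Rightarrow> real \<Rightarrow> complex \<Rightarrow> complex \<Rightarrow> complex \<Rightarrow> complex" where
  "Psit M m \<epsilon> j k \<tau> z1 z2 =
     qpow \<tau> (- (of_int m / of_int M) * j * k)
     * exp (- (2 * pi * \<i> * of_int m / of_int M) * (k * z1 + j * z2))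
     * Phit (- m) (of_int M * \<tau>) (z1 + j * \<tau> + \<epsilon>) (z2 + k * \<tau> + \<epsilon>)"

definition Pfun :: "int \<Rightarrow> int \<Rightarrow> real \<Rightarrow> real \<Rightarrow> real \<Rightarrow> complex \<Rightarrow> complex \<Rightarrow> complex \<Rightarrow> complex" where
  "Pfun M m \<epsilon> j k \<tau> z1 z2 =
     D0 (Psit M m \<epsilon> j k \<tau>) z1 z2
     + of_int m * (z1 - z2) / (2 * of_int M * \<tau>) * Psit M m \<epsilon> j k \<tau> z1 z2"

text \<open>$\vartheta_{ab}$ for $a, b \in \{0,1\}$.  The indices are real because they are used in the form
  $a = 1 - 2\epsilon'$, $b = 1 - 2\epsilon$; other values of the indices are irrelevant.\<close>

definition vartheta :: "real \<Rightarrow> real \<Rightarrow> complex \<Rightarrow> complex \<Rightarrow> complex" where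
  "vartheta a b \<tau> z =
     (if a = 0 then
        (if b = 0 then Theta 2 2 \<tau> z + Theta 0 2 \<tau> z else - Theta 2 2 \<tau> z + Theta 0 2 \<tau> z)
      else
        (if b = 0 then Theta 1 2 \<tau> z + Theta (-1) 2 \<tau> z
         else \<i> * Theta 1 2 \<tau> z - \<i> * Theta (-1) 2 \<tau> z))"

definition dedekind_eta :: "complex \<Rightarrow> complex" where
  "dedekind_eta \<tau> = qpow \<tau> (1/24) * (\<Prod>n. 1 - qpow \<tau> (of_nat (n + 1)))"

definition Rden :: "real \<Rightarrow> real \<Rightarrow> complex \<Rightarrow> complex \<Rightarrow> complex" where
  "Rden \<epsilon> \<epsilon>' \<tau> z =
     dedekind_eta \<tau> ^ 3 * (vartheta 1 1 \<tau> (2 * z) / (vartheta (1 - 2 * \<epsilon>') (1 - 2 * \<epsilon>) \<tau> z)\<^sup>2)"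

definition chi1 :: "int \<Rightarrow> int \<Rightarrow> real \<Rightarrow> real \<Rightarrow> real \<Rightarrow> real \<Rightarrow> complex \<Rightarrow> complex \<Rightarrow> complex" where
  "chi1 M m \<epsilon> \<epsilon>' j k \<tau> z = Pfun M m \<epsilon> j k \<tau> z z / Rden \<epsilon> \<epsilon>' \<tau> z"

definition chi0 :: "int \<Rightarrow> int \<Rightarrow> real \<Rightarrow> real \<Rightarrow> real \<Rightarrow> real \<Rightarrow> complex \<Rightarrow> complex \<Rightarrow> complex" where
  "chi0 M m \<epsilon> \<epsilon>' j k \<tau> z = Psit M m \<epsilon> j k \<tau> z z / Rden \<epsilon> \<epsilon>' \<tau> z"

section \<open>Weights of affine $ps\ell_{2|2}$\<close>

text \<open>A weight $c\Lambda_0 + a_1\alpha_1 + a_2\alpha_2 + a_3\alpha_3 + d\delta$ is represented by its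
  coordinates $(c, a_1, a_2, a_3, d)$; only real coefficients occur.  The vector $\alpha_1 - \alpha_3$
  lies in the radical of the form and vanishes on the Cartan subalgebra of $ps\ell_{2|2}$; nothing
  below depends on whether it is factored out.\<close>

type_synonym weight = "real \<times> real \<times> real \<times> real \<times> real"

definition Lam0 :: weight where "Lam0 = (1, 0, 0, 0, 0)"
definition alpha1 :: weight where "alpha1 = (0, 1, 0, 0, 0)"
definition alpha2 :: weight where "alpha2 = (0, 0, 1, 0, 0)"
definition alpha3 :: weight where "alpha3 = (0, 0, 0, 1, 0)"
definition delta :: weight where "delta = (0, 0, 0, 0, 1)"

fun wform :: "weight \<Rightarrow> weight \<Rightarrow> real" where
  "wform (c, a1, a2, a3, d) (c', a1', a2', a3', d') =
     c * d' + d * c' + a1 * a2' + a2 * a1' + a2 * a3' + a3 * a2' - 2 * a2 * a2'"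

text \<open>Since $h^\vee = 0$, the affine Weyl vector $h^\vee\Lambda_0 + \rho$ equals $\rho$.\<close>

definition rho :: weight where "rho = - (1/2) *\<^sub>R (alpha1 + alpha3)"

text \<open>The translation $t_\beta$; the level of \<open>\<mu>\<close> is $(\mu|\delta)$.\<close>

definition transl :: "weight \<Rightarrow> weight \<Rightarrow> weight" where
  "transl \<beta> \<mu> = \<mu> + wform \<mu> delta *\<^sub>R \<beta> - (wform \<mu> \<beta> + 1/2 * wform \<beta> \<beta> * wform \<mu> delta) *\<^sub>R delta"

definition wrefl :: "weight \<Rightarrow> weight \<Rightarrow> weight" where
  "wrefl \<alpha> \<mu> = \<mu> - (2 * wform \<mu> \<alpha> / wform \<alpha> \<alpha>) *\<^sub>R \<alpha>"

datatype adm_type = Type_I | Type_III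

fun adm_y :: "adm_type \<Rightarrow> weight \<Rightarrow> weight" where
  "adm_y Type_I = id"
| "adm_y Type_III = wrefl alpha2"

fun adm_beta :: "adm_type \<Rightarrow> int \<Rightarrow> int \<Rightarrow> weight" where
  "adm_beta Type_I k1 k2 =
     - ((2 * of_int k1 + of_int k2) / 2) *\<^sub>R (alpha1 + alpha3) - of_int k1 *\<^sub>R alpha2"
| "adm_beta Type_III k1 k2 =
     - ((2 * of_int k1 + of_int k2) / 2) *\<^sub>R (alpha1 + alpha3) - (of_int k1 + of_int k2) *\<^sub>R alpha2"

fun adm_range :: "adm_type \<Rightarrow> int \<Rightarrow> int \<Rightarrow> int \<Rightarrow> bool" where
  "adm_range Type_I M k1 k2 \<longleftrightarrow> 0 \<le> k1 \<and> 0 \<le> k2 \<and> 2 * k1 + k2 \<le> M - 1"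
| "adm_range Type_III M k1 k2 \<longleftrightarrow> 0 \<le> k1 \<and> 1 \<le> k2 \<and> 2 * k1 + k2 \<le> M - 1"

definition Lam_int :: "int \<Rightarrow> int \<Rightarrow> weight" where
  "Lam_int m m2 = of_int m *\<^sub>R Lam0 - (of_int m2 / 2) *\<^sub>R (alpha1 + alpha3)"

text \<open>$\Lambda^{[m;m_2]J}_{k_1,k_2}$ for the denominator $M$, that is, of level $K = m/M$.\<close>

definition Lam_adm :: "int \<Rightarrow> int \<Rightarrow> int \<Rightarrow> adm_type \<Rightarrow> int \<Rightarrow> int \<Rightarrow> weight" where
  "Lam_adm m M m2 J k1 k2 =
     transl (adm_beta J k1 k2)
       (adm_y J (Lam_int m m2 - ((of_int M - 1) * (of_int m / of_int M)) *\<^sub>R Lam0 + rho)) - rho"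

lemma Lam_adm_alpha2:
  assumes "M > 0"
  shows "wform (Lam_adm m M m2 Type_I k1 k2) alpha2 = - (of_int m / of_int M) * of_int k2 - of_int m2"
    and "wform (Lam_adm m M m2 Type_III k1 k2) alpha2 = of_int m / of_int M * of_int k2 + of_int m2 + 2"
  using assms
  by (simp_all add: Lam_adm_def transl_def wrefl_def Lam_int_def rho_def Lam0_def delta_def
      alpha1_def alpha2_def alpha3_def field_simps)

section \<open>Modified numerators and (super)characters\<close>

text \<open>The modified numerators and characters are attached to the data $(m, M, m_2, J, k_1, k_2)$
  defining the weight: the weight alone does not determine $M$.\<close>

definition numer_I ::
  "int \<Rightarrow> int \<Rightarrow> int \<Rightarrow> int \<Rightarrow> int \<Rightarrow> complex \<Rightarrow> complex \<Rightarrow> complex \<Rightarrow> complex \<Rightarrow> complex" where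
  "numer_I m M m2 k1 k2 \<tau> z1 z2 t =
     exp (2 * pi * \<i> * of_int m / of_int M * t)
     * exp (2 * pi * \<i> * of_int m / of_int M * (of_int (k1 + k2) * z1 - of_int k1 * z2))
     * qpow \<tau> (of_int m / of_int M * of_int k1 * of_int (k1 + k2))
     * (let F = Phit (- m) (of_int M * \<tau>); w1 = z1 + of_int k1 * \<tau>; w2 = z2 - of_int (k1 + k2) * \<tau>
        in D0 F w1 w2 - of_int m2 * F w1 w2)"

fun numer_minus ::
  "int \<Rightarrow> int \<Rightarrow> int \<Rightarrow> adm_type \<Rightarrow> int \<Rightarrow> int \<Rightarrow> complex \<Rightarrow> complex \<Rightarrow> complex \<Rightarrow> complex \<Rightarrow> complex" where
  "numer_minus m M m2 Type_I k1 k2 \<tau> z1 z2 t = numer_I m M m2 k1 k2 \<tau> z1 z2 t"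
| "numer_minus m M m2 Type_III k1 k2 \<tau> z1 z2 t = numer_I m M m2 k1 k2 \<tau> (- z2) (- z1) t"

definition numer_plus ::
  "int \<Rightarrow> int \<Rightarrow> int \<Rightarrow> adm_type \<Rightarrow> int \<Rightarrow> int \<Rightarrow> complex \<Rightarrow> complex \<Rightarrow> complex \<Rightarrow> complex \<Rightarrow> complex" where
  "numer_plus m M m2 J k1 k2 \<tau> z1 z2 t =
     - exp (pi * \<i> * wform (Lam_adm m M m2 J k1 k2) alpha2)
     * numer_minus m M m2 J k1 k2 \<tau> (z1 + 1/2) (z2 + 1/2) t"

text \<open>\<open>\<epsilon> = 0\<close> selects $N^-$ (supercharacter), \<open>\<epsilon> = 1/2\<close> selects $N^+$ (character).\<close>

definition numer ::
  "real \<Rightarrow> int \<Rightarrow> int \<Rightarrow> int \<Rightarrow> adm_type \<Rightarrow> int \<Rightarrow> int \<Rightarrow> complex \<Rightarrow> complex \<Rightarrow> complex \<Rightarrow> complex \<Rightarrow> complex" where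
  "numer \<epsilon> = (if \<epsilon> = 0 then numer_minus else numer_plus)"

definition numer_tw ::
  "real \<Rightarrow> int \<Rightarrow> int \<Rightarrow> int \<Rightarrow> adm_type \<Rightarrow> int \<Rightarrow> int \<Rightarrow> complex \<Rightarrow> complex \<Rightarrow> complex \<Rightarrow> complex \<Rightarrow> complex" where
  "numer_tw \<epsilon> m M m2 J k1 k2 \<tau> z1 z2 t =
     numer \<epsilon> m M m2 J k1 k2 \<tau> (- z2 - \<tau> / 2) (- z1 - \<tau> / 2) (t - (z1 + z2) / 2 - \<tau> / 4)"

definition ch_H ::
  "real \<Rightarrow> int \<Rightarrow> int \<Rightarrow> int \<Rightarrow> adm_type \<Rightarrow> int \<Rightarrow> int \<Rightarrow> complex \<Rightarrow> complex \<Rightarrow> complex" where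
  "ch_H \<epsilon> m M m2 J k1 k2 \<tau> z =
     numer \<epsilon> m M m2 J k1 k2 \<tau> (z + \<tau> / 2) (z - \<tau> / 2) (\<tau> / 4) / Rden \<epsilon> (1/2) \<tau> z"

definition ch_Htw ::
  "real \<Rightarrow> int \<Rightarrow> int \<Rightarrow> int \<Rightarrow> adm_type \<Rightarrow> int \<Rightarrow> int \<Rightarrow> complex \<Rightarrow> complex \<Rightarrow> complex" where
  "ch_Htw \<epsilon> m M m2 J k1 k2 \<tau> z =
     numer_tw \<epsilon> m M m2 J k1 k2 \<tau> (z + \<tau> / 2) (z - \<tau> / 2) (\<tau> / 4) / Rden \<epsilon> 0 \<tau> z"

text \<open>The condition that all functions of $z$ in the character formulas are defined.  The zeros of
  $\vartheta_{11}(\tau,2z)$ are exactly the points with $2z \in \mathbb{Z} + \mathbb{Z}\tau$, and these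
  include the zeros of all $\vartheta_{ab}(\tau,z)$ and the poles of the numerators.\<close>

definition generic_point :: "complex \<Rightarrow> complex \<Rightarrow> bool" where
  "generic_point \<tau> z \<longleftrightarrow> (\<forall>a b::int. 2 * z \<noteq> of_int a + of_int b * \<tau>)"

end

theory Submission
  imports Defs "HOL-Complex_Analysis.Complex_Analysis" "HOL-Probability.Distributions"
begin

text \<open>
Fix \<open>\<tau>\<close> and put $G(w_1,w_2) = ((D_0 - m_2)\tilde\Phi^{[-m;0]})(M\tau,w_1,w_2)$.  Both sides of the character
formulas are a phase times a value of $G$, divided by the same denominator $R^{(\epsilon)}_{\epsilon'}$.  On the right-hand side
$D_0$ acts on $\tilde\Psi$, an exponential times a translate of $\tilde\Phi$; by the product rule it produces the constant
$\frac{m}{M}(j-k)$, which the coefficient of $\chi^{(0)}$ removes, and the term of $P$ with $z_1-z_2$ vanishes on the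
diagonal.  What remains is the phase times $G(z+j\tau+\epsilon, z+k\tau+\epsilon)$ (\<open>chi_combination\<close>).  On the left-hand
side the substitutions defining the reductions and the twist give the same phase times $G$ at a point which
agrees with $(z+j\tau+\epsilon, z+k\tau+\epsilon)$ up to the reflection $(w_1,w_2) \mapsto (-w_2,-w_1)$ and a common shift by $1$.
Under the reflection $G$ changes sign (\<open>D0_minus_Phit_antisym\<close>), under the shift it is invariant
(\<open>D0_minus_Phit_shift\<close>).  For $\epsilon = \frac12$ the factor $e^{\pi i(\Lambda|\alpha_2)}$ cancels the phase caused by the half-period shift up
to the sign $(-1)^{m_2}$.

The analytic content lies in the product rule: since $\tilde\Phi$ is not holomorphic, it requires that $\tilde\Phi$ be
differentiable in the real and imaginary directions of either variable at every point off the poles.  For $\Theta$ and $\Phi_1$ this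
follows from the Weierstrass test.  In $R_{j;\ell}$ the non-holomorphic function $E$ occurs at an argument that is affine
along real lines; replacing $E$ by its entire extension makes every term holomorphic in a complexified line
parameter, with Gaussian decay inherited from $|\mathrm{sgn}\,x - E(x)| \le e^{-\pi x^2}$, and the Weierstrass test applies
again (\<open>Rcorr_ray_differentiable\<close>).  The second variable reduces to the first by the antisymmetry of $\tilde\Phi$.
\<close>

section \<open>Holomorphy of series with Gaussian decay\<close>

lemma summable_on_exp_neg_abs_int: "(\<lambda>r::int. exp (- \<bar>real_of_int r\<bar>)) summable_on UNIV"
proof -
  have nat: "(\<lambda>n::nat. exp (- real n)) summable_on UNIV"
  proof (rule norm_summable_imp_summable_on)
    have "summable (\<lambda>n. exp (- 1 :: real) ^ n)"
      by (rule summable_geometric) simp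
    then show "summable (\<lambda>n. norm (exp (- real n)))"
      by (simp add: exp_of_nat_mult [symmetric])
  qed
  have "(\<lambda>r::int. exp (- \<bar>real_of_int r\<bar>)) summable_on (range int)"
    using nat by (subst summable_on_reindex) (auto simp: o_def)
  moreover have "(\<lambda>r::int. exp (- \<bar>real_of_int r\<bar>)) summable_on (range (\<lambda>n. - int n))"
    using nat by (subst summable_on_reindex) (auto simp: o_def inj_on_def)
  moreover have "range int \<union> range (\<lambda>n. - int n) = UNIV"
  proof -
    have "r \<in> range int \<union> range (\<lambda>n. - int n)" for r :: int
      by (cases r rule: int_cases2) auto
    then show ?thesis by auto
  qed
  ultimately show ?thesis
    using summable_on_union by metis
qed

text \<open>Completing the square bounds the summand by a constant times $e^{-|r|}$.  All series below are
majorised by such a Gaussian, the linear term coming from the elliptic variables.\<close>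

lemma summable_on_gaussian_int:
  fixes c B :: real
  assumes "c > 0"
  shows "(\<lambda>r::int. exp (B * \<bar>real_of_int r\<bar> - c * (real_of_int r)\<^sup>2)) summable_on UNIV"
proof (rule summable_on_comparison_test)
  show "(\<lambda>r::int. exp ((B + 1)\<^sup>2 / (4 * c)) * exp (- \<bar>real_of_int r\<bar>)) summable_on UNIV"
    by (intro summable_on_cmult_right summable_on_exp_neg_abs_int)
next
  fix r :: int
  have "0 \<le> (B + 1 - 2 * c * \<bar>real_of_int r\<bar>)\<^sup>2 / (4 * c)" using assms by simp
  also have "\<dots> = (B + 1)\<^sup>2 / (4 * c) - (B + 1) * \<bar>real_of_int r\<bar> + c * (real_of_int r)\<^sup>2"
    using assms by (simp add: power2_diff power_mult_distrib field_simps) (simp add: power2_eq_square)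
  finally show "exp (B * \<bar>real_of_int r\<bar> - c * (real_of_int r)\<^sup>2)
      \<le> exp ((B + 1)\<^sup>2 / (4 * c)) * exp (- \<bar>real_of_int r\<bar>)"
    by (simp add: exp_add [symmetric] algebra_simps)
qed auto

text \<open>The Weierstrass test on the unit disc.  The finite exceptional set \<open>F\<close> lets a majorant be valid only
for large indices: near a zero of a denominator of $\Phi_1$, or where a sign function in $R$ differs
from the sign of the argument of $E$, the terms are handled one at a time at the centre.\<close>

lemma infsum_field_differentiable_at_0:
  fixes f :: "'a \<Rightarrow> complex \<Rightarrow> complex" and M :: "'a \<Rightarrow> real"
  assumes F: "finite F" "F \<subseteq> A"
    and dF: "\<And>n. n \<in> F \<Longrightarrow> f n field_differentiable (at 0)"
    and hol: "\<And>n. n \<in> A - F \<Longrightarrow> f n holomorphic_on cball 0 1"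
    and bd: "\<And>n z. n \<in> A - F \<Longrightarrow> z \<in> cball 0 1 \<Longrightarrow> norm (f n z) \<le> M n"
    and M: "M summable_on (A - F)"
  shows "(\<lambda>z. \<Sum>\<^sub>\<infinity>n\<in>A. f n z) field_differentiable (at 0)"
proof -
  let ?g = "\<lambda>z. \<Sum>\<^sub>\<infinity>n\<in>A - F. f n z"
  have ul: "uniform_limit (cball 0 1) (\<lambda>X z. \<Sum>n\<in>X. f n z) ?g (finite_subsets_at_top (A - F))"
    using bd M by (rule Weierstrass_m_test_general)
  have ev: "\<forall>\<^sub>F X in finite_subsets_at_top (A - F).
      continuous_on (cball 0 1) (\<lambda>z. \<Sum>n\<in>X. f n z) \<and> (\<lambda>z. \<Sum>n\<in>X. f n z) holomorphic_on ball 0 1"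
  proof (rule eventually_finite_subsets_at_top_weakI)
    fix X assume X: "finite X" "X \<subseteq> A - F"
    then have "(\<lambda>z. \<Sum>n\<in>X. f n z) holomorphic_on cball 0 1"
      by (intro holomorphic_on_sum hol) auto
    then show "continuous_on (cball 0 1) (\<lambda>z. \<Sum>n\<in>X. f n z) \<and> (\<lambda>z. \<Sum>n\<in>X. f n z) holomorphic_on ball 0 1"
      by (meson ball_subset_cball holomorphic_on_imp_continuous_on holomorphic_on_subset)
  qed
  have "?g holomorphic_on ball 0 1"
    using holomorphic_uniform_limit [OF ev ul] by (metis finite_subsets_at_top_neq_bot)
  then have g: "?g field_differentiable (at 0)"
    by (rule holomorphic_on_imp_differentiable_at) auto
  have sumF: "(\<lambda>z. \<Sum>n\<in>F. f n z) field_differentiable (at 0)"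
    by (intro field_differentiable_sum dF)
  have eq: "(\<Sum>n\<in>F. f n z) + ?g z = (\<Sum>\<^sub>\<infinity>n\<in>A. f n z)" if "dist z 0 < 1" for z
  proof -
    have "(\<lambda>n. f n z) summable_on (A - F)"
    proof (rule abs_summable_summable)
      show "(\<lambda>n. norm (f n z)) summable_on (A - F)"
        by (rule summable_on_comparison_test [OF M]) (use bd that in \<open>auto simp: dist_norm\<close>)
    qed
    then have "(\<Sum>\<^sub>\<infinity>n\<in>F \<union> (A - F). f n z) = (\<Sum>\<^sub>\<infinity>n\<in>F. f n z) + ?g z"
      using F by (intro infsum_Un_disjoint) auto
    moreover have "F \<union> (A - F) = A" using F by auto
    ultimately show ?thesis using F by simp
  qed
  show ?thesis
    by (rule field_differentiable_transform_within
          [OF _ _ _ field_differentiable_add [OF sumF g], of 1]) (use eq in auto)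
qed

section \<open>The error function\<close>

lemma E_has_real_derivative: "(E has_real_derivative 2 * exp (- pi * x\<^sup>2)) (at x)"
proof -
  define b where "b = \<bar>x\<bar> + 1"
  have "((\<lambda>u. LBINT y=0..u. exp (- pi * y\<^sup>2)) has_vector_derivative exp (- pi * x\<^sup>2)) (at x within {-b..b})"
    unfolding zero_ereal_def
    by (rule interval_integral_FTC2) (auto simp: b_def intro!: continuous_on_exp continuous_on_mult continuous_on_minus continuous_on_power continuous_on_const continuous_on_id)
  then have "((\<lambda>u. LBINT y=0..u. exp (- pi * y\<^sup>2)) has_vector_derivative exp (- pi * x\<^sup>2)) (at x)"
    by (subst (asm) at_within_interior) (auto simp: b_def)
  then have "((\<lambda>u. LBINT y=0..u. exp (- pi * y\<^sup>2)) has_real_derivative exp (- pi * x\<^sup>2)) (at x)"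
    by (simp add: has_real_derivative_iff_has_vector_derivative)
  from DERIV_cmult [OF this, of 2] show ?thesis
    by (simp add: E_def [abs_def])
qed

lemma E_0 [simp]: "E 0 = 0"
  by (simp add: E_def zero_ereal_def [symmetric])

lemma E_minus: "E (- x) = - E x"
proof -
  have "((\<lambda>x. E x + E (- x)) has_real_derivative 0) (at y)" for y
    using DERIV_add [OF E_has_real_derivative [of y]
        DERIV_chain2 [OF E_has_real_derivative [of "- y"] DERIV_minus [OF DERIV_ident]]] by simp
  then have "E x + E (- x) = E 0 + E (- 0)"
    by (rule DERIV_isconst_all [rule_format]) 
  then show ?thesis by simp
qed

text \<open>The Gaussian integral, after the substitution $u = \sqrt\pi\, x$.\<close>

lemma E_tendsto_1: "(E \<longlongrightarrow> 1) at_top"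
proof -
  have g: "has_bochner_integral lborel (\<lambda>x. indicator {0..} x *\<^sub>R exp (- x\<^sup>2)) (sqrt pi / 2)"
    by (rule gaussian_moment_0)
  have "has_bochner_integral lborel (\<lambda>x. indicator {0..} (0 + sqrt pi * x) *\<^sub>R exp (- (0 + sqrt pi * x)\<^sup>2))
      ((sqrt pi / 2) /\<^sub>R \<bar>sqrt pi\<bar>)"
    by (rule lborel_has_bochner_integral_real_affine_iff [THEN iffD1, OF _ g]) simp
  then have h: "has_bochner_integral lborel (\<lambda>x. indicator {0..} x *\<^sub>R exp (- pi * x\<^sup>2)) (1 / 2)"
  proof (rule back_subst [where P = "\<lambda>f. f"])
    show "has_bochner_integral lborel (\<lambda>x. indicator {0..} (0 + sqrt pi * x) *\<^sub>R exp (- (0 + sqrt pi * x)\<^sup>2))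
      ((sqrt pi / 2) /\<^sub>R \<bar>sqrt pi\<bar>) = has_bochner_integral lborel (\<lambda>x. indicator {0..} x *\<^sub>R exp (- pi * x\<^sup>2)) (1 / 2 :: real)"
      by (intro arg_cong2 [where f = "has_bochner_integral lborel"] ext)
         (use pi_gt_zero in \<open>auto simp: power_mult_distrib indicator_def zero_le_mult_iff simp del: pi_gt_zero\<close>)
  qed
  then have "((\<lambda>y. LINT x|lborel. indicator {..y} x *\<^sub>R (indicator {0..} x *\<^sub>R exp (- pi * x\<^sup>2))) \<longlongrightarrow>
      (LINT x|lborel. indicator {0..} x *\<^sub>R exp (- pi * x\<^sup>2))) at_top"
    by (intro tendsto_integral_at_top) (auto simp: has_bochner_integral_iff)
  then have "((\<lambda>y. LINT x|lborel. indicator {..y} x *\<^sub>R (indicator {0..} x *\<^sub>R exp (- pi * x\<^sup>2))) \<longlongrightarrow>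
      1 / 2) at_top"
    by (subst (asm) has_bochner_integral_integral_eq [OF h])
  then have "((\<lambda>y. 2 * (LINT x|lborel. indicator {..y} x *\<^sub>R (indicator {0..} x *\<^sub>R exp (- pi * x\<^sup>2)))) \<longlongrightarrow>
      2 * (1 / 2)) at_top"
    by (intro tendsto_mult tendsto_const)
  moreover have "\<forall>\<^sub>F y in at_top. 2 * (LINT x|lborel. indicator {..y} x *\<^sub>R (indicator {0..} x *\<^sub>R exp (- pi * x\<^sup>2))) = E y"
    using eventually_ge_at_top [of 0]
  proof eventually_elim
    case (elim y)
    have "E y = 2 * (LBINT x:{0..y}. exp (- pi * x\<^sup>2))"
      using elim by (simp add: E_def zero_ereal_def interval_integral_Icc)
    also have "\<dots> = 2 * (LINT x|lborel. indicator {..y} x *\<^sub>R (indicator {0..} x *\<^sub>R exp (- pi * x\<^sup>2)))"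
      unfolding set_lebesgue_integral_def
      by (intro arg_cong [where f = "\<lambda>x. 2 * x"] Bochner_Integration.integral_cong)
         (auto simp: indicator_def)
    finally show ?case by simp
  qed
  ultimately show ?thesis
    by (simp add: filterlim_cong [OF refl refl])
qed

text \<open>For $u \ge 1$ the derivative of $E(u) - 1 + e^{-\pi u^2}$ is $2e^{-\pi u^2}(1 - \pi u) < 0$, so this function
decreases to its limit $0$ and is nonnegative; and $E$ increases to $1$.\<close>

lemma E_tail_pos:
  assumes "x \<ge> 1"
  shows "\<bar>1 - E x\<bar> \<le> exp (- pi * x\<^sup>2)"
proof -
  have lim: "((\<lambda>u. E u - 1 + exp (- pi * u\<^sup>2)) \<longlongrightarrow> 1 - 1 + 0) at_top"
    by (intro tendsto_intros E_tendsto_1) real_asymp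
  have "E u - 1 + exp (- pi * u\<^sup>2) \<le> E x - 1 + exp (- pi * x\<^sup>2)" if "x \<le> u" for u
  proof (rule DERIV_nonpos_imp_nonincreasing [OF that])
    fix y assume "x \<le> y" "y \<le> u"
    then have "1 \<le> pi * y"
      using assms pi_gt3 by (smt (verit) mult_le_cancel_left1)
    moreover have "((\<lambda>u. E u - 1 + exp (- pi * u\<^sup>2)) has_real_derivative
        2 * exp (- pi * y\<^sup>2) * (1 - pi * y)) (at y)"
      by (auto intro!: derivative_eq_intros E_has_real_derivative simp: algebra_simps)
    ultimately show "\<exists>d. ((\<lambda>u. E u - 1 + exp (- pi * u\<^sup>2)) has_real_derivative d) (at y) \<and> d \<le> 0"
      by (intro exI conjI) (auto simp: mult_le_0_iff)
  qed
  then have "\<forall>\<^sub>F u in at_top. E u - 1 + exp (- pi * u\<^sup>2) \<le> E x - 1 + exp (- pi * x\<^sup>2)"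
    by (auto simp: eventually_at_top_linorder)
  then have lo: "0 \<le> E x - 1 + exp (- pi * x\<^sup>2)"
    using tendsto_upperbound [OF lim] by simp
  have "E x \<le> E u" if "x \<le> u" for u
    by (rule DERIV_nonneg_imp_nondecreasing [OF that]) (use E_has_real_derivative in force)
  then have "\<forall>\<^sub>F u in at_top. E x \<le> E u"
    by (auto simp: eventually_at_top_linorder)
  then have "E x \<le> 1"
    using tendsto_lowerbound [OF E_tendsto_1] by simp
  with lo show ?thesis by simp
qed

lemma E_tail:
  assumes "\<bar>x\<bar> \<ge> 1"
  shows "\<bar>sgn x - E x\<bar> \<le> exp (- pi * x\<^sup>2)"
  using E_tail_pos [of x] E_tail_pos [of "- x"] assms
  by (cases "x > 0") (auto simp: E_minus abs_if split: if_splits)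

text \<open>The argument of $E$ in $R$ involves $\mathrm{Im}\,v$.  Along a real line through \<open>v\<close> it is an affine function of
the line parameter, so extending $E$ to an entire function makes each term of $R$ holomorphic in
that parameter, and the Weierstrass test applies with bounds on the terms alone.\<close>

lemma E_entire_extension:
  obtains g :: "complex \<Rightarrow> complex"
  where "\<And>z :: complex. (g has_field_derivative 2 * exp (- pi * z\<^sup>2)) (at z)"
    and "\<And>x. g (of_real x) = of_real (E x)"
proof -
  have hol: "(\<lambda>z::complex. 2 * exp (- pi * z\<^sup>2)) holomorphic_on UNIV"
    by (intro holomorphic_intros)
  obtain h :: "complex \<Rightarrow> complex"
    where h': "\<And>z :: complex. z \<in> UNIV \<Longrightarrow> (h has_field_derivative 2 * exp (- pi * z\<^sup>2)) (at z within UNIV)"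
    by (rule holomorphic_convex_primitive' [OF convex_UNIV open_UNIV hol]) blast
  have h: "(h has_field_derivative 2 * exp (- pi * z\<^sup>2)) (at z)" for z :: complex
    using h' [of z] by simp
  define g where "g z = h z - h 0" for z
  have g: "(g has_field_derivative 2 * exp (- pi * z\<^sup>2)) (at z)" for z :: complex
    unfolding g_def [abs_def] by (auto intro!: derivative_eq_intros h)
  have "((\<lambda>x. g (of_real x) - of_real (E x)) has_vector_derivative 0) (at y within UNIV)" for y
  proof -
    have 1: "((\<lambda>x. g (of_real x)) has_vector_derivative 2 * exp (of_real (- pi) * (of_real y)\<^sup>2)) (at y)"
      by (rule has_vector_derivative_real_field [OF g])
    have 2: "((\<lambda>x. of_real (E x) :: complex) has_vector_derivative of_real (2 * exp (- pi * y\<^sup>2))) (at y)"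
      by (intro has_vector_derivative_of_real) (rule E_has_real_derivative)
    show ?thesis using has_vector_derivative_diff [OF 1 2]
      by (simp add: exp_of_real [symmetric])
  qed
  then obtain c where c': "\<And>x. x \<in> UNIV \<Longrightarrow> g (of_real x) - of_real (E x) = c"
    by (rule has_vector_derivative_zero_constant [OF convex_UNIV]) blast
  then have c: "g (of_real x) - of_real (E x) = c" for x by simp
  have "c = 0" using c [of 0] by (simp add: g_def)
  then have "g (of_real x) = of_real (E x)" for x using c [of x] by simp
  with g show ?thesis by (rule that)
qed

text \<open>On the vertical segment $|\mathrm{Im}\,w| \le b$ through \<open>z\<close> the derivative $2e^{-\pi w^2}$ is of size $e^{-\pi(\mathrm{Re}\,w)^2}$, so the
extension keeps the decay of $\mathrm{sgn} - E$ in horizontal strips.\<close>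

lemma E_extension_bound:
  fixes g :: "complex \<Rightarrow> complex"
  assumes g: "\<And>z :: complex. (g has_field_derivative 2 * exp (- pi * z\<^sup>2)) (at z)"
    and y: "\<bar>Im z\<bar> \<le> b"
  shows "norm (g z - g (of_real (Re z))) \<le> 2 * b * exp (pi * b\<^sup>2) * exp (- pi * (Re z)\<^sup>2)"
proof -
  let ?S = "{w. Re w = Re z} \<inter> {w. \<bar>Im w\<bar> \<le> b}"
  have b: "0 \<le> b" using y by linarith
  have cv: "convex ?S"
  proof (rule convex_Int)
    show "convex {w. Re w = Re z}"
      using convex_hyperplane [of "1 :: complex" "Re z"] by (simp add: inner_complex_def del: inner_real_def)
    have "{w. \<bar>Im w\<bar> \<le> b} = {w. Im w \<le> b} \<inter> {w. Im w \<ge> - b}" by auto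
    then show "convex {w. \<bar>Im w\<bar> \<le> b}"
      by (simp add: convex_Int convex_halfspace_Im_le convex_halfspace_Im_ge)
  qed
  have nb: "norm (2 * exp (- pi * w\<^sup>2)) \<le> 2 * exp (pi * b\<^sup>2) * exp (- pi * (Re z)\<^sup>2)" if "w \<in> ?S" for w :: complex
  proof -
    have "(Im w)\<^sup>2 \<le> b\<^sup>2" using that b by (simp add: abs_le_square_iff [symmetric])
    then have "pi * (Im w)\<^sup>2 \<le> pi * b\<^sup>2" by simp
    moreover have "Re (- pi * w\<^sup>2) = pi * (Im w)\<^sup>2 - pi * (Re z)\<^sup>2"
      using that by (simp add: power2_eq_square algebra_simps)
    ultimately show ?thesis
      by (simp add: norm_mult exp_add [symmetric])
  qed
  have "norm (g z - g (of_real (Re z))) \<le> 2 * exp (pi * b\<^sup>2) * exp (- pi * (Re z)\<^sup>2) * norm (z - of_real (Re z))"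
    by (rule field_differentiable_bound [OF cv has_field_derivative_at_within [OF g] nb]) (use b y in auto)
  also have "z - of_real (Re z) = \<i> * of_real (Im z)" by (simp add: complex_eq_iff)
  also have "2 * exp (pi * b\<^sup>2) * exp (- pi * (Re z)\<^sup>2) * norm (\<i> * of_real (Im z))
      \<le> 2 * exp (pi * b\<^sup>2) * exp (- pi * (Re z)\<^sup>2) * b"
    using y by (intro mult_left_mono) (auto simp: norm_mult)
  finally show ?thesis by (simp add: mult_ac)
qed

section \<open>Differentiability of $\Theta$, $\Phi_1$, $R$ and $\tilde\Phi$\<close>

lemma abs_Im_ray_le:
  assumes "norm z \<le> 1"
  shows "\<bar>Im (a + d * z)\<bar> \<le> norm a + norm d"
proof -
  have "\<bar>Im (a + d * z)\<bar> \<le> norm (a + d * z)" by (rule abs_Im_le_cmod)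
  also have "\<dots> \<le> norm a + norm d * norm z" by (metis norm_mult norm_triangle_ineq)
  also have "\<dots> \<le> norm a + norm d" using assms by (simp add: mult_left_le)
  finally show ?thesis .
qed

lemma Theta_field_differentiable:
  assumes l: "l > 0" and T: "Im T > 0"
  shows "(\<lambda>z. Theta j l T (a + d * z)) field_differentiable (at 0)"
proof -
  define L where "L = real_of_int l"
  define s where "s = real_of_int j / (2 * L)"
  define B where "B = norm a + norm d"
  have L: "L > 0" using l by (simp add: L_def)
  define f where "f n z = exp (2 * pi * \<i> * (of_real (L * (real_of_int n + s)\<^sup>2) * T
      + of_real (L * (real_of_int n + s)) * (a + d * z)))" for n z
  have eq: "Theta j l T (a + d * z) = (\<Sum>\<^sub>\<infinity>n\<in>UNIV. f n z)" for z
    unfolding Theta_def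
    by (rule infsum_cong) (simp add: f_def Let_def qpow_def L_def s_def exp_add [symmetric] algebra_simps)
  have "(\<lambda>z. \<Sum>\<^sub>\<infinity>n\<in>UNIV. f n z) field_differentiable (at 0)"
  proof (rule infsum_field_differentiable_at_0 [where F = "{}"])
    show "f n holomorphic_on cball 0 1" for n
      unfolding f_def [abs_def] by (intro holomorphic_intros)
  next
    fix n z assume "z \<in> cball (0::complex) 1"
    then have Im: "\<bar>Im (a + d * z)\<bar> \<le> B" unfolding B_def by (intro abs_Im_ray_le) simp
    let ?n = "real_of_int n"
    have "- ((?n + s) * Im (a + d * z)) \<le> \<bar>?n + s\<bar> * \<bar>Im (a + d * z)\<bar>"
      by (metis abs_ge_minus_self abs_mult)
    also have "\<dots> \<le> (\<bar>?n\<bar> + \<bar>s\<bar>) * B"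
      using Im by (intro mult_mono) auto
    finally have 1: "- ((?n + s) * Im (a + d * z)) \<le> (\<bar>?n\<bar> + \<bar>s\<bar>) * B" .
    have "- (?n * s) \<le> \<bar>?n\<bar> * \<bar>s\<bar>" by (metis abs_ge_minus_self abs_mult)
    moreover have "0 \<le> s\<^sup>2" by simp
    ultimately have "- (?n + s)\<^sup>2 \<le> 2 * \<bar>?n\<bar> * \<bar>s\<bar> - ?n\<^sup>2"
      unfolding power2_sum by linarith
    then have 2: "- (?n + s)\<^sup>2 * Im T \<le> (2 * \<bar>?n\<bar> * \<bar>s\<bar> - ?n\<^sup>2) * Im T"
      by (rule mult_right_mono) (use T in simp)
    have "norm (f n z) = exp (2 * pi * L * (- (?n + s)\<^sup>2 * Im T - (?n + s) * Im (a + d * z)))"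
      unfolding f_def norm_exp_eq_Re by (simp add: algebra_simps)
    also have "\<dots> \<le> exp (2 * pi * L * ((2 * \<bar>?n\<bar> * \<bar>s\<bar> - ?n\<^sup>2) * Im T + (\<bar>?n\<bar> + \<bar>s\<bar>) * B))"
      unfolding exp_le_cancel_iff using 1 2 L by (intro mult_left_mono) auto
    also have "\<dots> = exp (2 * pi * L * \<bar>s\<bar> * B)
        * exp ((2 * pi * L * B + 4 * pi * L * Im T * \<bar>s\<bar>) * \<bar>?n\<bar> - 2 * pi * L * Im T * ?n\<^sup>2)"
      by (simp add: exp_add [symmetric] algebra_simps)
    finally show "norm (f n z) \<le> \<dots>" .
  next
    show "(\<lambda>n. exp (2 * pi * L * \<bar>s\<bar> * B) * exp ((2 * pi * L * B + 4 * pi * L * Im T * \<bar>s\<bar>) * \<bar>real_of_int n\<bar>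
        - 2 * pi * L * Im T * (real_of_int n)\<^sup>2)) summable_on UNIV - {}"
      unfolding Diff_empty
      by (intro summable_on_cmult_right summable_on_gaussian_int) (use L T in auto)
  qed auto
  then show ?thesis by (simp add: eq)
qed

text \<open>The condition $z \notin \mathbb{Z} + \mathbb{Z}T$, in the form in which it keeps the denominators of
$\Phi_1$ away from zero.\<close>

definition off_lattice :: "complex \<Rightarrow> complex \<Rightarrow> bool" where
  "off_lattice T z \<longleftrightarrow> (\<forall>n::int. exp (2 * pi * \<i> * z) * qpow T (of_int n) \<noteq> 1)"

lemma off_lattice_minus:
  assumes "off_lattice T z" shows "off_lattice T (- z)"
  unfolding off_lattice_def
proof (intro allI notI)
  fix n :: int
  assume "exp (2 * pi * \<i> * - z) * qpow T (of_int n) = 1"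
  moreover have "(exp (2 * pi * \<i> * z) * qpow T (of_int (- n))) * (exp (2 * pi * \<i> * - z) * qpow T (of_int n)) = 1"
    by (simp add: qpow_def exp_add [symmetric] algebra_simps)
  ultimately show False using assms unfolding off_lattice_def by (metis mult.right_neutral)
qed

lemma finite_bounded_ints: "finite {n::int. \<bar>real_of_int n\<bar> < c}"
proof (rule finite_subset)
  show "{n::int. \<bar>real_of_int n\<bar> < c} \<subseteq> {- \<lceil>c\<rceil>..\<lceil>c\<rceil>}"
    by (auto simp: abs_less_iff) linarith+
qed auto

text \<open>For all but finitely many \<open>n\<close> the number $|e^{2\pi i z_1}q^n|$ is at most $1/2$ or at least $2$ throughout the disc,
which bounds the denominator from below by $1/2$; the remaining terms are differentiable at the
centre because \<open>a\<close> is not a pole.\<close>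

lemma Phi1_field_differentiable:
  assumes l: "l > 0" and T: "Im T > 0" and a: "off_lattice T a"
  shows "(\<lambda>z. Phi1 l T (a + d * z) (b + e * z)) field_differentiable (at 0)"
proof -
  define L where "L = real_of_int l"
  have L: "L > 0" using l by (simp add: L_def)
  define B where "B = norm a + norm d + (norm b + norm e)"
  define g where "g n z = exp (2 * pi * \<i> * (of_real (L * real_of_int n) * ((a + d * z) + (b + e * z))
      + of_real (L * (real_of_int n)\<^sup>2) * T))" for n z
  define h where "h n z = exp (2 * pi * \<i> * (a + d * z)) * qpow T (of_int n)" for n :: int and z
  define F where "F = {n::int. \<bar>real_of_int n\<bar> < (B + 1) / Im T}"
  have eq: "Phi1 l T (a + d * z) (b + e * z) = (\<Sum>\<^sub>\<infinity>n\<in>UNIV. g n z / (1 - h n z))" for z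
    unfolding Phi1_def
    by (rule infsum_cong) (simp add: g_def h_def qpow_def L_def exp_add [symmetric] algebra_simps)
  have far: "1/2 \<le> norm (1 - h n z)" if n: "n \<notin> F" and z: "z \<in> cball 0 1" for n z
  proof -
    have "\<bar>Im (a + d * z)\<bar> \<le> B"
      using abs_Im_ray_le [of z a d] z unfolding B_def by (smt (verit) norm_ge_zero mem_cball_0)
    moreover have nT: "\<bar>real_of_int n * Im T\<bar> \<ge> B + 1"
      using n T by (simp add: F_def not_less abs_mult field_simps)
    ultimately have x: "\<bar>Im (a + d * z) + real_of_int n * Im T\<bar> \<ge> 1" by linarith
    have nh: "norm (h n z) = exp (- (2 * pi * (Im (a + d * z) + real_of_int n * Im T)))"
      unfolding h_def qpow_def exp_add [symmetric] norm_exp_eq_Re by (simp add: algebra_simps)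
    have "(2::real) \<le> exp 1" using exp_ge_add_one_self [of 1] by simp
    moreover have "exp 1 \<le> exp (2 * pi)" using pi_gt3 by simp
    ultimately have e2: "2 \<le> exp (2 * pi)" by linarith
    have "norm (h n z) \<le> 1/2 \<or> norm (h n z) \<ge> 2"
    proof (cases "Im (a + d * z) + real_of_int n * Im T \<ge> 1")
      case True
      then have "norm (h n z) \<le> exp (- (2 * pi))" unfolding nh by simp
      also have "\<dots> = 1 / exp (2 * pi)" by (simp add: exp_minus divide_inverse)
      also have "\<dots> \<le> 1/2" using e2 by (simp add: field_simps)
      finally show ?thesis by simp
    next
      case False
      with x have "Im (a + d * z) + real_of_int n * Im T \<le> - 1" by linarith
      then have "2 * pi * (Im (a + d * z) + real_of_int n * Im T) \<le> 2 * pi * (-1)"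
        by (intro mult_left_mono) auto
      then have "exp (2 * pi) \<le> norm (h n z)" unfolding nh by simp
      with e2 show ?thesis by simp
    qed
    then show ?thesis
      using norm_triangle_ineq3 [of 1 "h n z"] by auto
  qed
  have "(\<lambda>z. \<Sum>\<^sub>\<infinity>n\<in>UNIV. g n z / (1 - h n z)) field_differentiable (at 0)"
  proof (rule infsum_field_differentiable_at_0 [where F = F])
    show "finite F" unfolding F_def by (rule finite_bounded_ints)
  next
    fix n assume "n \<in> F"
    have "h n 0 \<noteq> 1" using a by (simp add: h_def off_lattice_def)
    moreover have "g n field_differentiable (at 0)"
      unfolding g_def [abs_def]
      by (rule holomorphic_on_imp_differentiable_at [of _ UNIV]) (auto intro!: holomorphic_intros)
    moreover have "(\<lambda>z. 1 - h n z) field_differentiable (at 0)"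
      unfolding h_def [abs_def]
      by (rule holomorphic_on_imp_differentiable_at [of _ UNIV]) (auto intro!: holomorphic_intros)
    ultimately show "(\<lambda>z. g n z / (1 - h n z)) field_differentiable (at 0)"
      by (intro field_differentiable_divide) auto
  next
    fix n assume n: "n \<in> UNIV - F"
    show "(\<lambda>z. g n z / (1 - h n z)) holomorphic_on cball 0 1"
    proof (rule holomorphic_on_divide)
      show "1 - h n z \<noteq> 0" if "z \<in> cball 0 1" for z
        using far [OF _ that, of n] n by auto
    qed (auto simp: g_def [abs_def] h_def [abs_def] intro!: holomorphic_intros)
    fix z assume z: "z \<in> cball (0::complex) 1"
    let ?n = "real_of_int n"
    have "\<bar>Im ((a + d * z) + (b + e * z))\<bar> \<le> B"
      using abs_Im_ray_le [of z a d] abs_Im_ray_le [of z b e] z unfolding B_def by simp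
    then have "\<bar>?n\<bar> * \<bar>Im ((a + d * z) + (b + e * z))\<bar> \<le> \<bar>?n\<bar> * B"
      by (intro mult_left_mono) auto
    moreover have "- (?n * Im ((a + d * z) + (b + e * z))) \<le> \<bar>?n\<bar> * \<bar>Im ((a + d * z) + (b + e * z))\<bar>"
      by (metis abs_ge_minus_self abs_mult)
    ultimately have 1: "- (?n * Im ((a + d * z) + (b + e * z))) - ?n\<^sup>2 * Im T \<le> \<bar>?n\<bar> * B - ?n\<^sup>2 * Im T" by linarith
    have "norm (g n z) = exp (2 * pi * L * (- (?n * Im ((a + d * z) + (b + e * z))) - ?n\<^sup>2 * Im T))"
      unfolding g_def norm_exp_eq_Re by (simp add: algebra_simps)
    also have "\<dots> \<le> exp (2 * pi * L * (\<bar>?n\<bar> * B - ?n\<^sup>2 * Im T))"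
      unfolding exp_le_cancel_iff using L by (intro mult_left_mono [OF 1]) auto
    finally have "norm (g n z / (1 - h n z)) \<le> exp (2 * pi * L * (\<bar>?n\<bar> * B - ?n\<^sup>2 * Im T)) / (1/2)"
      unfolding norm_divide using far [OF _ z, of n] n by (intro frac_le) auto
    then show "norm (g n z / (1 - h n z)) \<le> 2 * exp ((2 * pi * L * B) * \<bar>?n\<bar> - 2 * pi * L * Im T * ?n\<^sup>2)"
      by (simp add: algebra_simps)
  next
    have "(\<lambda>n. 2 * exp ((2 * pi * L * B) * \<bar>real_of_int n\<bar> - 2 * pi * L * Im T * (real_of_int n)\<^sup>2)) summable_on UNIV"
      by (intro summable_on_cmult_right summable_on_gaussian_int) (use L T in auto)
    then show "(\<lambda>n. 2 * exp ((2 * pi * L * B) * \<bar>real_of_int n\<bar> - 2 * pi * L * Im T * (real_of_int n)\<^sup>2)) summable_on UNIV - F"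
      by (rule summable_on_subset_banach) auto
  qed auto
  then show ?thesis by (simp add: eq)
qed

lemma differentiable_of_real_comp:
  assumes "f field_differentiable (at (0::complex))"
  shows "(\<lambda>x::real. f (of_real x)) differentiable (at 0)"
proof -
  obtain f' where "(f has_field_derivative f') (at (of_real 0))"
    using assms by (auto simp: field_differentiable_def)
  from has_vector_derivative_real_field [OF this] show ?thesis
    using differentiableI_vector by blast
qed

text \<open>The exponential in the term of index $r$ grows like $e^{\pi r^2\,\mathrm{Im}T/(2\ell)}$, while the factor
$\mathrm{sgn} - E$ decays like $e^{-\pi r^2\,\mathrm{Im}T/\ell}$, twice as fast in the exponent.  The sign function in the
definition agrees with the sign of the argument of $E$ once $|r|$ is large.\<close>

lemma Rcorr_ray_differentiable:
  assumes l: "l > 0" and T: "Im T > 0"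
  shows "(\<lambda>x::real. Rcorr j l T (a + d * of_real x)) differentiable (at 0)"
proof -
  obtain g :: "complex \<Rightarrow> complex"
    where g: "\<And>z :: complex. (g has_field_derivative 2 * exp (- pi * z\<^sup>2)) (at z)"
      and gE: "\<And>x. g (of_real x) = of_real (E x)"
    by (rule E_entire_extension) blast
  have g_hol: "g holomorphic_on UNIV"
    by (simp add: holomorphic_on_open) (use g in blast)
  define L where "L = real_of_int l"
  have L: "L > 0" using l by (simp add: L_def)
  define B where "B = norm a + norm d"
  define k where "k = sqrt (Im T / L)"
  have k: "k > 0" and k2: "k\<^sup>2 = Im T / L" using L T by (auto simp: k_def)
  \<comment> \<open>\<open>Q\<close> bounds the displacement \<open>h\<close> of the argument of \<open>E\<close>, and \<open>u\<close> is the exponential factor of the term\<close>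
  define Q where "Q = 2 * L / Im T * B"
  define h where "h z = of_real (2 * L / Im T) * (of_real (Im a) + of_real (Im d) * z)" for z :: complex
  define w where "w r z = (of_int r - h z) * of_real k" for r :: int and z
  define u where "u r z = exp (- (pi * \<i> * of_int r ^ 2 / (2 * of_int l)) * T
      + 2 * pi * \<i> * of_int r * (a + d * z))" for r :: int and z
  define \<sigma> where "\<sigma> r = sgn (real_of_int r - 1/2 - of_int j + 2 * of_int l)" for r :: int
  define f where "f r z = (of_real (\<sigma> r) - g (w r z)) * u r z" for r z
  define A where "A = {r::int. r mod (2 * l) = j mod (2 * l)}"
  \<comment> \<open>Off \<open>F\<close> the argument of \<open>E\<close> has real part of modulus at least 1, and \<open>r\<close> dominates the shifts in both signs.\<close>
  define F where "F = A \<inter> {r::int. \<bar>real_of_int r\<bar> < Q + 1 / k + (2 * L + \<bar>real_of_int j\<bar> + 1)}"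
  define C where "C = 1 + 2 * (Q * k) * exp (pi * (Q * k)\<^sup>2)"
  have Q: "Q \<ge> 0" using L T by (auto simp: Q_def B_def)
  have C: "C \<ge> 0" using Q k by (auto simp: C_def)
  have f_hol: "f r holomorphic_on S" for r S
  proof -
    have "(g \<circ> w r) holomorphic_on S"
      by (rule holomorphic_on_compose_gen [OF _ g_hol])
         (auto simp: w_def [abs_def] h_def [abs_def] intro!: holomorphic_intros)
    then show ?thesis
      unfolding f_def [abs_def] u_def [abs_def] o_def by (intro holomorphic_intros) auto
  qed
  have h_le: "norm (h z) \<le> Q" if "z \<in> cball 0 1" for z
  proof -
    have "norm (of_real (Im a) + of_real (Im d) * z) \<le> \<bar>Im a\<bar> + \<bar>Im d\<bar> * norm z"
      by (metis norm_mult norm_of_real norm_triangle_ineq)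
    also have "\<dots> \<le> norm a + norm d * 1"
      using that by (intro add_mono mult_mono abs_Im_le_cmod) auto
    finally have "2 * L / Im T * norm (of_real (Im a) + of_real (Im d) * z) \<le> Q"
      unfolding Q_def B_def using L T by (intro mult_left_mono) auto
    then show ?thesis
      unfolding h_def norm_mult norm_of_real using L T by simp
  qed
  have "(\<lambda>z. \<Sum>\<^sub>\<infinity>r\<in>A. f r z) field_differentiable (at 0)"
  proof (rule infsum_field_differentiable_at_0 [where F = F])
    show "finite F" unfolding F_def by (intro finite_Int disjI2 finite_bounded_ints)
    show "F \<subseteq> A" by (auto simp: F_def)
    show "f r field_differentiable (at 0)" for r
      using f_hol [of r UNIV] by (rule holomorphic_on_imp_differentiable_at) auto
    show "f r holomorphic_on cball 0 1" for r by (rule f_hol)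
  next
    fix r z assume r: "r \<in> A - F" and z: "z \<in> cball (0::complex) 1"
    let ?r = "real_of_int r" and ?x = "Re (w r z)"
    have r_far: "\<bar>?r\<bar> \<ge> Q + 1 / k + (2 * L + \<bar>real_of_int j\<bar> + 1)"
      using r by (auto simp: F_def)
    have hz: "\<bar>Re (h z)\<bar> \<le> Q" "\<bar>Im (h z)\<bar> \<le> Q"
      using h_le [OF z] abs_Re_le_cmod [of "h z"] abs_Im_le_cmod [of "h z"] by linarith+
    have x: "?x = (?r - Re (h z)) * k" by (simp add: w_def)
    have "0 < 1 / k" using k by simp
    with r_far hz(1) Q L have *: "\<bar>?r - Re (h z)\<bar> \<ge> 1 / k" by linarith
    then have x1: "\<bar>?x\<bar> \<ge> 1" unfolding x abs_mult using k by (simp add: field_simps)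
    have "sgn ?x = sgn (?r - Re (h z))" unfolding x using k by (simp add: sgn_mult)
    also have "\<dots> = \<sigma> r"
    proof (cases "?r \<ge> 0")
      case True
      then have "?r - Re (h z) > 0" "?r - 1/2 - of_int j + 2 * L > 0"
        using r_far hz(1) L \<open>0 < 1 / k\<close> Q by linarith+
      then show ?thesis by (simp add: \<sigma>_def L_def)
    next
      case False
      then have "?r - Re (h z) < 0" "?r - 1/2 - of_int j + 2 * L < 0"
        using r_far hz(1) L \<open>0 < 1 / k\<close> Q by linarith+
      then show ?thesis by (simp add: \<sigma>_def L_def)
    qed
    finally have sg: "sgn ?x = \<sigma> r" .
    have 1: "\<bar>\<sigma> r - E ?x\<bar> \<le> exp (- pi * ?x\<^sup>2)"
      using E_tail [OF x1] by (simp add: sg)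
    have "\<bar>Im (w r z)\<bar> \<le> Q * k"
      using hz(2) k by (simp add: w_def abs_mult)
    then have 2: "norm (g (w r z) - of_real (E ?x)) \<le> 2 * (Q * k) * exp (pi * (Q * k)\<^sup>2) * exp (- pi * ?x\<^sup>2)"
      using E_extension_bound [of g, OF g] by (metis gE)
    have "of_real (\<sigma> r) - g (w r z) = of_real (\<sigma> r - E ?x) - (g (w r z) - of_real (E ?x))" by simp
    also have "norm \<dots> \<le> \<bar>\<sigma> r - E ?x\<bar> + norm (g (w r z) - of_real (E ?x))"
      by (metis norm_of_real norm_triangle_ineq4)
    also have "\<dots> \<le> C * exp (- pi * ?x\<^sup>2)"
      using 1 2 unfolding C_def by (simp add: algebra_simps)
    also have "\<dots> \<le> C * exp (2 * pi * Q * (Im T / L) * \<bar>?r\<bar> - pi * (Im T / L) * ?r\<^sup>2)"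
    proof -
      have "?r * Re (h z) \<le> \<bar>?r\<bar> * \<bar>Re (h z)\<bar>" by (metis abs_ge_self abs_mult)
      also have "\<dots> \<le> \<bar>?r\<bar> * Q" by (intro mult_left_mono hz) auto
      finally have "?r\<^sup>2 - 2 * Q * \<bar>?r\<bar> \<le> (?r - Re (h z))\<^sup>2"
        using zero_le_power2 [of "Re (h z)"]
        unfolding power2_diff mult.assoc mult.commute [of Q "\<bar>?r\<bar>"] by linarith
      then have "pi * (Im T / L) * (?r\<^sup>2 - 2 * Q * \<bar>?r\<bar>) \<le> pi * (Im T / L) * (?r - Re (h z))\<^sup>2"
        using L T by (intro mult_left_mono) auto
      also have "\<dots> = pi * ?x\<^sup>2" unfolding x power_mult_distrib k2 by simp
      finally have "- pi * ?x\<^sup>2 \<le> 2 * pi * Q * (Im T / L) * \<bar>?r\<bar> - pi * (Im T / L) * ?r\<^sup>2"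
        by (simp add: algebra_simps)
      then show ?thesis using C by (intro mult_left_mono) auto
    qed
    finally have 3: "norm (of_real (\<sigma> r) - g (w r z))
        \<le> C * exp (2 * pi * Q * (Im T / L) * \<bar>?r\<bar> - pi * (Im T / L) * ?r\<^sup>2)" .
    have "- (?r * Im (a + d * z)) \<le> \<bar>?r\<bar> * \<bar>Im (a + d * z)\<bar>" by (metis abs_ge_minus_self abs_mult)
    also have "\<dots> \<le> \<bar>?r\<bar> * B"
      unfolding B_def using z by (intro mult_left_mono abs_Im_ray_le) auto
    finally have "2 * pi * - (?r * Im (a + d * z)) \<le> 2 * pi * (\<bar>?r\<bar> * B)"
      by (rule mult_left_mono) auto
    then have "exp (pi * ?r\<^sup>2 / (2 * L) * Im T + 2 * pi * - (?r * Im (a + d * z)))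
        \<le> exp (pi * ?r\<^sup>2 / (2 * L) * Im T + 2 * pi * (\<bar>?r\<bar> * B))"
      unfolding exp_le_cancel_iff by (rule add_left_mono)
    moreover have "norm (u r z) = exp (pi * ?r\<^sup>2 / (2 * L) * Im T + 2 * pi * - (?r * Im (a + d * z)))"
    proof -
      have Re_scale: "Re (of_real c * w) = c * Re w" for c w by simp
      have arg: "- (pi * \<i> * of_int r ^ 2 / (2 * of_int l)) * T + 2 * pi * \<i> * of_int r * v
          = of_real (pi * ?r\<^sup>2 / (2 * L)) * (- \<i> * T) + of_real (2 * pi * ?r) * (\<i> * v)" for v
        by (simp add: L_def)
      have Re_arg: "Re (of_real (pi * ?r\<^sup>2 / (2 * L)) * (- \<i> * T) + of_real (2 * pi * ?r) * (\<i> * v))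
          = pi * ?r\<^sup>2 / (2 * L) * Im T + 2 * pi * - (?r * Im v)" for v
        by (simp only: plus_complex.sel Re_scale) simp
      show ?thesis by (simp only: u_def norm_exp_eq_Re arg Re_arg)
    qed
    ultimately have 4: "norm (u r z) \<le> exp (pi * ?r\<^sup>2 / (2 * L) * Im T + 2 * pi * (\<bar>?r\<bar> * B))"
      by (simp only:)
    have "norm (f r z) \<le> (C * exp (2 * pi * Q * (Im T / L) * \<bar>?r\<bar> - pi * (Im T / L) * ?r\<^sup>2))
        * exp (pi * ?r\<^sup>2 / (2 * L) * Im T + 2 * pi * (\<bar>?r\<bar> * B))"
      unfolding f_def norm_mult using C by (intro mult_mono 3 4) auto
    also have "\<dots> = C * exp ((2 * pi * Q * (Im T / L) + 2 * pi * B) * \<bar>?r\<bar> - (pi * Im T / (2 * L)) * ?r\<^sup>2)"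
    proof -
      have "2 * pi * Q * (Im T / L) * \<bar>?r\<bar> - pi * (Im T / L) * ?r\<^sup>2
          + (pi * ?r\<^sup>2 / (2 * L) * Im T + 2 * pi * (\<bar>?r\<bar> * B))
          = (2 * pi * Q * (Im T / L) + 2 * pi * B) * \<bar>?r\<bar> - (pi * Im T / (2 * L)) * ?r\<^sup>2"
        using L by (simp add: divide_simps) (simp add: algebra_simps)
      then show ?thesis by (simp only: mult.assoc exp_add [symmetric])
    qed
    finally show "norm (f r z) \<le> \<dots>" .
  next
    have "(\<lambda>r::int. C * exp ((2 * pi * Q * (Im T / L) + 2 * pi * B) * \<bar>real_of_int r\<bar>
        - (pi * Im T / (2 * L)) * (real_of_int r)\<^sup>2)) summable_on UNIV"
      by (intro summable_on_cmult_right summable_on_gaussian_int) (use L T in auto)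
    then show "(\<lambda>r::int. C * exp ((2 * pi * Q * (Im T / L) + 2 * pi * B) * \<bar>real_of_int r\<bar>
        - (pi * Im T / (2 * L)) * (real_of_int r)\<^sup>2)) summable_on A - F"
      by (rule summable_on_subset_banach) auto
  qed
  then have "(\<lambda>x::real. \<Sum>\<^sub>\<infinity>r\<in>A. f r (of_real x)) differentiable (at 0)"
    by (rule differentiable_of_real_comp)
  also have "(\<lambda>x::real. \<Sum>\<^sub>\<infinity>r\<in>A. f r (of_real x)) = (\<lambda>x. Rcorr j l T (a + d * of_real x))"
  proof
    fix x :: real
    have "w r (of_real x) = of_real ((real_of_int r - 2 * of_int l * (Im (a + d * of_real x) / Im T))
        * sqrt (Im T / of_int l))" for r
      by (simp add: w_def h_def k_def L_def field_simps)
    then have "f r (of_real x) = of_real (\<sigma> r - E ((real_of_int r - 2 * of_int l * (Im (a + d * of_real x) / Im T))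
        * sqrt (Im T / of_int l))) * u r (of_real x)" for r
      unfolding f_def by (simp only: gE of_real_diff)
    then show "(\<Sum>\<^sub>\<infinity>r\<in>A. f r (of_real x)) = Rcorr j l T (a + d * of_real x)"
      unfolding Rcorr_def A_def \<sigma>_def u_def by (simp only:)
  qed
  finally show ?thesis .
qed

lemma Phit_ray_differentiable_left:
  assumes l: "l > 0" and T: "Im T > 0" and z: "off_lattice T z1" "off_lattice T z2"
  shows "(\<lambda>x::real. Phit l T (z1 + d * of_real x) z2) differentiable (at 0)"
proof -
  have P1: "(\<lambda>x::real. Phi1 l T (z1 + d * of_real x) (z2 + 0 * of_real x)) differentiable (at 0)"
    by (rule differentiable_of_real_comp [OF Phi1_field_differentiable [OF l T z(1)]])
  have P2: "(\<lambda>x::real. Phi1 l T (- z2 + 0 * of_real x) (- z1 + (- d) * of_real x)) differentiable (at 0)"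
    by (rule differentiable_of_real_comp [OF Phi1_field_differentiable [OF l T off_lattice_minus [OF z(2)]]])
  have Th: "(\<lambda>x::real. Theta j l T (z1 + z2 + d * of_real x)) differentiable (at 0)" for j
    by (rule differentiable_of_real_comp [OF Theta_field_differentiable [OF l T]])
  have R: "(\<lambda>x::real. Rcorr j l T ((z1 - z2) / 2 + d / 2 * of_real x)) differentiable (at 0)" for j
    by (rule Rcorr_ray_differentiable [OF l T])
  have eq: "(\<lambda>x::real. Phit l T (z1 + d * of_real x) z2) = (\<lambda>x::real.
      (Phi1 l T (z1 + d * of_real x) (z2 + 0 * of_real x)
        - Phi1 l T (- z2 + 0 * of_real x) (- z1 + (- d) * of_real x))
      + 1/2 * (\<Sum>j\<in>{0..2 * l - 1}. Rcorr j l T ((z1 - z2) / 2 + d / 2 * of_real x)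
        * (Theta (- j) l T (z1 + z2 + d * of_real x) - Theta j l T (z1 + z2 + d * of_real x))))"
    by (rule ext) (simp add: Phit_def Phi_def diff_divide_distrib add_divide_distrib algebra_simps)
  show ?thesis
    unfolding eq
    by (intro differentiable_add differentiable_diff differentiable_mult differentiable_sum
        differentiable_const ballI finite_atLeastAtMost_int P1 P2 R Th)
qed

section \<open>Symmetries of $\tilde\Phi$\<close>

lemma Theta_minus: "Theta (- j) l T (- z) = Theta j l T z"
  unfolding Theta_def Let_def
  by (rule infsum_reindex_bij_witness [of _ uminus uminus]) (auto simp: algebra_simps power2_eq_square)

text \<open>$\Phi$ is antisymmetric by construction; $z_1 - z_2$ is invariant under $(z_1, z_2) \mapsto (-z_2, -z_1)$, so the
coefficients $R_{j;\ell}$ are unchanged, while the differences of theta functions are odd in $z_1 + z_2$.\<close>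

lemma Phit_antisym: "Phit l T (- z2) (- z1) = - Phit l T z1 z2"
proof -
  have 1: "Theta j l T (- z2 + - z1) = Theta (- j) l T (z1 + z2)" for j
    using Theta_minus [of "- j" l T "z1 + z2"] by (simp add: add.commute)
  have 2: "(- z2 - - z1) / 2 = (z1 - z2) / 2" by simp
  show ?thesis
    unfolding Phit_def Phi_def 1 2 by (simp add: algebra_simps sum_subtractf)
qed

lemma Phit_ray_differentiable_right:
  assumes l: "l > 0" and T: "Im T > 0" and z: "off_lattice T z1" "off_lattice T z2"
  shows "(\<lambda>x::real. Phit l T z1 (z2 + d * of_real x)) differentiable (at 0)"
proof -
  \<comment> \<open>The antisymmetry turns the second variable into the first.\<close>
  have "(\<lambda>x::real. - Phit l T (- z2 + (- d) * of_real x) (- z1)) differentiable (at 0)"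
    by (intro differentiable_minus Phit_ray_differentiable_left assms off_lattice_minus)
  also have "(\<lambda>x::real. - Phit l T (- z2 + (- d) * of_real x) (- z1)) = (\<lambda>x. Phit l T z1 (z2 + d * of_real x))"
    using Phit_antisym [of l T "z2 + d * of_real x" z1 for x] by (auto simp: algebra_simps)
  finally show ?thesis .
qed

lemma Theta_plus_2:
  assumes "l \<noteq> 0" shows "Theta j l T (z + 2) = Theta j l T z"
  unfolding Theta_def Let_def
proof (rule infsum_cong)
  fix n :: int
  have "2 * pi * \<i> * of_int l * (of_int n + of_int j / (2 * of_int l)) * (z + 2)
      = 2 * pi * \<i> * of_int l * (of_int n + of_int j / (2 * of_int l)) * z + \<i> * (of_int (2 * l * n + j) * (of_real pi * 2))"
    using assms by (simp add: field_simps)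
  then have e: "exp (2 * pi * \<i> * of_int l * (of_int n + of_int j / (2 * of_int l)) * (z + 2))
      = exp (2 * pi * \<i> * of_int l * (of_int n + of_int j / (2 * of_int l)) * z)"
    by (simp only: exp_plus_2pin)
  show "qpow T (of_int l * (of_int n + of_int j / (2 * of_int l))\<^sup>2)
        * exp (2 * pi * \<i> * of_int l * (of_int n + of_int j / (2 * of_int l)) * (z + 2)) =
      qpow T (of_int l * (of_int n + of_int j / (2 * of_int l))\<^sup>2)
        * exp (2 * pi * \<i> * of_int l * (of_int n + of_int j / (2 * of_int l)) * z)"
    unfolding e ..
qed

lemma exp_period: "exp (2 * pi * \<i> * (z + of_int n)) = exp (2 * pi * \<i> * z)"
proof -
  have "2 * pi * \<i> * (z + of_int n) = 2 * pi * \<i> * z + \<i> * (of_int n * (of_real pi * 2))"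
    by (simp add: algebra_simps)
  then show ?thesis by (simp only: exp_plus_2pin)
qed

lemma Phi1_shift: "Phi1 l T (z1 + of_int n) (z2 + of_int n) = Phi1 l T z1 z2"
  unfolding Phi1_def
proof (rule infsum_cong)
  fix j :: int
  have "2 * pi * \<i> * of_int l * of_int j * (z1 + of_int n + (z2 + of_int n))
      = 2 * pi * \<i> * (of_int l * of_int j * (z1 + z2) + of_int (2 * l * j * n))"
    by (simp add: algebra_simps)
  then have "exp (2 * pi * \<i> * of_int l * of_int j * (z1 + of_int n + (z2 + of_int n)))
      = exp (2 * pi * \<i> * of_int l * of_int j * (z1 + z2))"
    by (simp only: exp_period) (simp add: mult.assoc)
  then show "exp (2 * pi * \<i> * of_int l * of_int j * (z1 + of_int n + (z2 + of_int n))) * qpow T (of_int j ^ 2 * of_int l)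
        / (1 - exp (2 * pi * \<i> * (z1 + of_int n)) * qpow T (of_int j))
     = exp (2 * pi * \<i> * of_int l * of_int j * (z1 + z2)) * qpow T (of_int j ^ 2 * of_int l)
        / (1 - exp (2 * pi * \<i> * z1) * qpow T (of_int j))"
    by (simp only: exp_period)
qed

text \<open>Shifting both arguments by $1$ changes $z_1 + z_2$ by $2$, and $2 \ell r \in \mathbb{Z}$ for every exponent $r$ of
$\Theta_{j,\ell}$.\<close>

lemma Phit_shift:
  assumes "l \<noteq> 0" shows "Phit l T (z1 + 1) (z2 + 1) = Phit l T z1 z2"
proof -
  have 1: "Phi1 l T (z1 + 1) (z2 + 1) = Phi1 l T z1 z2"
    using Phi1_shift [of l T z1 1 z2] by simp
  have 2: "Phi1 l T (- (z2 + 1)) (- (z1 + 1)) = Phi1 l T (- z2) (- z1)"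
    using Phi1_shift [of l T "- z2" "- 1" "- z1"] by simp
  have 3: "z1 + 1 + (z2 + 1) = z1 + z2 + 2" by simp
  show ?thesis
    unfolding Phit_def Phi_def 1 2 3 Theta_plus_2 [OF assms] by simp
qed

section \<open>The Wirtinger derivative\<close>

text \<open>\<^const>\<open>wirtinger\<close> differentiates along the two coordinate directions; asking for all directions
makes the notion invariant under $w \mapsto -w$.\<close>

definition ray_differentiable :: "(complex \<Rightarrow> complex) \<Rightarrow> complex \<Rightarrow> bool" where
  "ray_differentiable f z \<longleftrightarrow> (\<forall>d. (\<lambda>x::real. f (z + d * of_real x)) differentiable (at 0))"

lemma ray_differentiableD:
  assumes "ray_differentiable f z"
  shows "((\<lambda>x::real. f (z + d * of_real x)) has_vector_derivative
      vector_derivative (\<lambda>x::real. f (z + d * of_real x)) (at 0)) (at 0)"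
  using assms vector_derivative_works by (auto simp: ray_differentiable_def)

lemma wirtinger_eq:
  assumes "((\<lambda>x::real. f (z + 1 * of_real x)) has_vector_derivative a) (at 0)"
    and "((\<lambda>y::real. f (z + \<i> * of_real y)) has_vector_derivative b) (at 0)"
  shows "wirtinger f z = (a - \<i> * b) / 2"
  using assms [THEN vector_derivative_at] by (simp add: wirtinger_def)

text \<open>The product rule: the Wirtinger derivative treats the holomorphic factor as its complex derivative
demands.\<close>

lemma wirtinger_exp_mult_shift:
  assumes f: "ray_differentiable f (z + b)"
  shows "wirtinger (\<lambda>w. c * exp (a * w) * f (w + b)) z
      = c * exp (a * z) * (a * f (z + b) + wirtinger f (z + b))"
proof -
  define D where "D d = vector_derivative (\<lambda>x::real. f (z + b + d * of_real x)) (at 0)" for d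
  have "((\<lambda>x::real. c * exp (a * (z + d * of_real x)) * f (z + d * of_real x + b)) has_vector_derivative
      c * exp (a * z) * (a * d * f (z + b) + D d)) (at 0)" for d
  proof -
    have "((\<lambda>x::complex. c * exp (a * (z + d * x))) has_field_derivative c * (a * d) * exp (a * z)) (at (of_real 0))"
      by (auto intro!: derivative_eq_intros)
    from has_vector_derivative_mult [OF has_vector_derivative_real_field [OF this] ray_differentiableD [OF f, of d]]
    show ?thesis by (simp add: D_def algebra_simps)
  qed
  note product = wirtinger_eq [OF this this]
  have D1: "D 1 = 2 * wirtinger f (z + b) + \<i> * D \<i>" by (simp add: wirtinger_def D_def diff_divide_distrib)
  show ?thesis
    unfolding product D1 by (simp add: algebra_simps)
qed

lemma wirtinger_minus_reflect:
  assumes f: "ray_differentiable f (- z)"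
  shows "wirtinger (\<lambda>w. - f (- w)) z = wirtinger f (- z)"
proof -
  have *: "((\<lambda>x::real. - f (- (d * of_real x) + - z)) has_vector_derivative
      vector_derivative (\<lambda>x::real. f (- z + d * of_real x)) (at 0)) (at 0)" for d
  proof -
    have "((\<lambda>x::real. f (- z + d * of_real x)) has_vector_derivative
        vector_derivative (\<lambda>x::real. f (- z + d * of_real x)) (at 0)) (at (- 0))"
      using ray_differentiableD [OF f] by simp
    moreover have "((\<lambda>x::real. - x) has_vector_derivative - 1) (at 0)"
      by (auto intro!: derivative_eq_intros)
    ultimately show ?thesis
      using has_vector_derivative_minus [OF vector_diff_chain_at [of uminus "- 1" 0 "\<lambda>x::real. f (- z + d * of_real x)"]]
      by (simp add: o_def add.commute [of "- z"])
  qed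
  have "((\<lambda>x::real. - f (- (z + d * of_real x))) has_vector_derivative
      vector_derivative (\<lambda>x::real. f (- z + d * of_real x)) (at 0)) (at 0)" for d
    using * [of d] by (simp only: minus_add_distrib add.commute [of "- z"])
  from wirtinger_eq [OF this this] show ?thesis
    by (simp add: wirtinger_def)
qed

lemma wirtinger_shift: "wirtinger (\<lambda>w. f (w + b)) z = wirtinger f (z + b)"
  by (simp add: wirtinger_def algebra_simps)

lemma Phit_ray_differentiable:
  assumes "l > 0" "Im T > 0" "off_lattice T w1" "off_lattice T w2"
  shows "ray_differentiable (\<lambda>w. Phit l T w w2) w1" and "ray_differentiable (\<lambda>w. Phit l T w1 w) w2"
  using Phit_ray_differentiable_left [OF assms] Phit_ray_differentiable_right [OF assms]
  by (simp_all add: ray_differentiable_def)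

section \<open>The operator $D_0 - m_2$\<close>

definition D0_minus :: "int \<Rightarrow> (complex \<Rightarrow> complex \<Rightarrow> complex) \<Rightarrow> complex \<Rightarrow> complex \<Rightarrow> complex" where
  "D0_minus c F w1 w2 = D0 F w1 w2 - of_int c * F w1 w2"

text \<open>Under $(w_1, w_2) \mapsto (-w_2, -w_1)$ the two partial derivatives are exchanged and change sign, so $D_0$
commutes with the substitution and the antisymmetry of $\tilde\Phi$ is inherited.\<close>

lemma D0_minus_Phit_antisym:
  assumes "l > 0" "Im T > 0" "off_lattice T w1" "off_lattice T w2"
  shows "D0_minus c (Phit l T) (- w2) (- w1) = - D0_minus c (Phit l T) w1 w2"
proof -
  have "(\<lambda>w. Phit l T w (- w1)) = (\<lambda>w. - Phit l T w1 (- w))"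
    using Phit_antisym [of l T "- w" w1 for w] by auto
  then have 1: "wirtinger (\<lambda>w. Phit l T w (- w1)) (- w2) = wirtinger (\<lambda>w. Phit l T w1 w) w2"
    using wirtinger_minus_reflect [of "\<lambda>w. Phit l T w1 w" "- w2"] Phit_ray_differentiable(2) [OF assms] by simp
  have "(\<lambda>w. Phit l T (- w2) w) = (\<lambda>w. - Phit l T (- w) w2)"
    using Phit_antisym [of l T w2 "- w" for w] by auto
  then have 2: "wirtinger (\<lambda>w. Phit l T (- w2) w) (- w1) = wirtinger (\<lambda>w. Phit l T w w2) w1"
    using wirtinger_minus_reflect [of "\<lambda>w. Phit l T w w2" "- w1"] Phit_ray_differentiable(1) [OF assms] by simp
  show ?thesis
    unfolding D0_minus_def D0_def 1 2 Phit_antisym by (simp add: algebra_simps)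
qed

lemma D0_minus_Phit_shift:
  assumes "l \<noteq> 0"
  shows "D0_minus c (Phit l T) (w1 + 1) (w2 + 1) = D0_minus c (Phit l T) w1 w2"
proof -
  have "wirtinger (\<lambda>w. Phit l T w (w2 + 1)) (w1 + 1) = wirtinger (\<lambda>w. Phit l T w w2) w1"
    unfolding wirtinger_shift [symmetric] Phit_shift [OF assms] ..
  moreover have "wirtinger (\<lambda>w. Phit l T (w1 + 1) w) (w2 + 1) = wirtinger (\<lambda>w. Phit l T w1 w) w2"
    unfolding wirtinger_shift [symmetric] Phit_shift [OF assms] ..
  ultimately show ?thesis
    by (simp add: D0_minus_def D0_def Phit_shift [OF assms])
qed

lemma D0_minus_Phit_shift_twice:
  fixes w1 w2 :: complex and \<epsilon> :: real
  assumes "l \<noteq> 0" and "\<epsilon> \<in> {0, 1/2}"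
  shows "D0_minus c (Phit l T) (w1 + 2 * \<epsilon>) (w2 + 2 * \<epsilon>) = D0_minus c (Phit l T) w1 w2"
proof -
  have "2 * \<epsilon> \<in> {0, 1}" using assms(2) by auto
  then have "complex_of_real (2 * \<epsilon>) \<in> {0, 1}" by (metis insertE insertI1 insertI2 of_real_0 of_real_1 singletonD)
  then have "2 * complex_of_real \<epsilon> \<in> {0, 1}" by (simp only: of_real_mult of_real_numeral)
  then show ?thesis using D0_minus_Phit_shift [OF assms(1)] by auto
qed

section \<open>Evaluation of $\chi^{(1)}$ and $\chi^{(0)}$\<close>

definition phase :: "int \<Rightarrow> int \<Rightarrow> complex \<Rightarrow> complex" where
  "phase m M x = exp (2 * pi * \<i> * of_int m / of_int M * x)"

lemma phase_add: "phase m M (x + y) = phase m M x * phase m M y"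
  by (simp add: phase_def exp_add distrib_left)

lemma Psit_eq:
  "Psit M m \<epsilon> j k \<tau> z1 z2 = phase m M (- (j * k * \<tau> + k * z1 + j * z2))
     * Phit (- m) (of_int M * \<tau>) (z1 + j * \<tau> + \<epsilon>) (z2 + k * \<tau> + \<epsilon>)"
  by (simp add: Psit_def phase_def qpow_def exp_add [symmetric] add_divide_distrib algebra_simps)

text \<open>The exponential factor of $\tilde\Psi$ contributes $\frac{m}{M}(j - k)$ to $D_0$; this is the constant subtracted in
the character formula.\<close>

lemma D0_Psit:
  fixes m M :: int and \<epsilon> j k :: real and \<tau> z1 z2 :: complex and F :: "complex \<Rightarrow> complex \<Rightarrow> complex"
  defines "F \<equiv> Phit (- m) (of_int M * \<tau>)"
  assumes "m < 0" "M > 0" "Im \<tau> > 0"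
    and "off_lattice (of_int M * \<tau>) (z1 + j * \<tau> + \<epsilon>)" "off_lattice (of_int M * \<tau>) (z2 + k * \<tau> + \<epsilon>)"
  shows "D0 (Psit M m \<epsilon> j k \<tau>) z1 z2 = phase m M (- (j * k * \<tau> + k * z1 + j * z2))
     * (of_int m * (j - k) / of_int M * F (z1 + j * \<tau> + \<epsilon>) (z2 + k * \<tau> + \<epsilon>)
        + D0 F (z1 + j * \<tau> + \<epsilon>) (z2 + k * \<tau> + \<epsilon>))"
proof -
  define w1 w2 where w: "w1 = z1 + (j * \<tau> + \<epsilon>)" "w2 = z2 + (k * \<tau> + \<epsilon>)"
  define K where "K = 2 * pi * \<i> * of_int m / of_int M"
  have exp_phase: "exp ((- K * x) * w) = phase m M (- (x * w))" for x w
    by (simp add: phase_def K_def mult.assoc)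
  define p where "p = phase m M (- (j * k * \<tau> + k * z1 + j * z2))"
  have rd: "ray_differentiable (\<lambda>w. F w w2) w1" "ray_differentiable (\<lambda>w. F w1 w) w2"
    unfolding F_def w by (intro Phit_ray_differentiable; use assms in \<open>simp add: add.assoc\<close>)+
  have "(\<lambda>w. Psit M m \<epsilon> j k \<tau> w z2)
      = (\<lambda>w. phase m M (- (j * k * \<tau> + j * z2)) * exp ((- K * k) * w) * F (w + (j * \<tau> + \<epsilon>)) w2)"
    unfolding Psit_eq exp_phase phase_add [symmetric] F_def w by (simp add: algebra_simps)
  then have "wirtinger (\<lambda>w. Psit M m \<epsilon> j k \<tau> w z2) z1
      = phase m M (- (j * k * \<tau> + j * z2)) * exp ((- K * k) * z1) * ((- K * k) * F w1 w2 + wirtinger (\<lambda>w. F w w2) w1)"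
    using wirtinger_exp_mult_shift [OF rd(1) [unfolded w(1)]] by (simp only: w(1))
  also have "phase m M (- (j * k * \<tau> + j * z2)) * exp ((- K * k) * z1) = p"
    unfolding p_def exp_phase phase_add [symmetric] by (simp add: algebra_simps)
  finally have 1: "wirtinger (\<lambda>w. Psit M m \<epsilon> j k \<tau> w z2) z1
      = p * ((- K * k) * F w1 w2 + wirtinger (\<lambda>w. F w w2) w1)" .
  have "(\<lambda>w. Psit M m \<epsilon> j k \<tau> z1 w)
      = (\<lambda>w. phase m M (- (j * k * \<tau> + k * z1)) * exp ((- K * j) * w) * F w1 (w + (k * \<tau> + \<epsilon>)))"
    unfolding Psit_eq exp_phase phase_add [symmetric] F_def w by (simp add: algebra_simps)
  then have "wirtinger (\<lambda>w. Psit M m \<epsilon> j k \<tau> z1 w) z2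
      = phase m M (- (j * k * \<tau> + k * z1)) * exp ((- K * j) * z2) * ((- K * j) * F w1 w2 + wirtinger (\<lambda>w. F w1 w) w2)"
    using wirtinger_exp_mult_shift [OF rd(2) [unfolded w(2)]] by (simp only: w(2))
  also have "phase m M (- (j * k * \<tau> + k * z1)) * exp ((- K * j) * z2) = p"
    unfolding p_def exp_phase phase_add [symmetric] by (simp add: algebra_simps)
  finally have 2: "wirtinger (\<lambda>w. Psit M m \<epsilon> j k \<tau> z1 w) z2
      = p * ((- K * j) * F w1 w2 + wirtinger (\<lambda>w. F w1 w) w2)" .
  have w': "z1 + j * \<tau> + \<epsilon> = w1" "z2 + k * \<tau> + \<epsilon> = w2" by (simp_all add: w)
  define c where "c = 1 / (2 * pi * \<i>)"
  have K: "c * K = of_int m / of_int M" by (simp add: K_def c_def)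
  have "D0 (Psit M m \<epsilon> j k \<tau>) z1 z2 = p * (c * K * (j - k) * F w1 w2 + D0 F w1 w2)"
    unfolding D0_def 1 2 c_def [symmetric] by (simp add: algebra_simps)
  then show ?thesis
    unfolding K w' p_def [symmetric] by simp
qed

text \<open>At $z_1 = z_2 = z$ the term with $z_1 - z_2$ in $P$ vanishes, and what $D_0$ picks up from the exponential
factor cancels.  What remains is a phase times $(D_0 - m_2)\tilde\Phi$.\<close>

lemma chi_combination:
  fixes \<epsilon> \<epsilon>' j k :: real and \<tau> z :: complex
  assumes "m < 0" "M > 0" "Im \<tau> > 0"
    and "off_lattice (of_int M * \<tau>) (z + j * \<tau> + \<epsilon>)" "off_lattice (of_int M * \<tau>) (z + k * \<tau> + \<epsilon>)"
  shows "chi1 M m \<epsilon> \<epsilon>' j k \<tau> z - (of_int m * (j - k) / of_int M + of_int m2) * chi0 M m \<epsilon> \<epsilon>' j k \<tau> z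
    = phase m M (- (j * k * \<tau> + (j + k) * z))
      * D0_minus m2 (Phit (- m) (of_int M * \<tau>)) (z + j * \<tau> + \<epsilon>) (z + k * \<tau> + \<epsilon>) / Rden \<epsilon> \<epsilon>' \<tau> z"
proof -
  have "k * z + j * z = (j + k) * z" by (simp add: algebra_simps)
  then have ph: "j * k * \<tau> + k * z + j * z = j * k * \<tau> + (j + k) * z" by (simp add: algebra_simps)
  have "Pfun M m \<epsilon> j k \<tau> z z - (of_int m * (j - k) / of_int M + of_int m2) * Psit M m \<epsilon> j k \<tau> z z
    = phase m M (- (j * k * \<tau> + (j + k) * z))
      * D0_minus m2 (Phit (- m) (of_int M * \<tau>)) (z + j * \<tau> + \<epsilon>) (z + k * \<tau> + \<epsilon>)"
    unfolding Pfun_def D0_Psit [OF assms] Psit_eq ph D0_minus_def by (simp add: algebra_simps)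
  then show ?thesis
    unfolding chi1_def chi0_def by (simp add: diff_divide_distrib [symmetric])
qed

text \<open>For half-integral $j$ and $\epsilon$, a relation $z + j\tau + \epsilon \in \mathbb{Z} + M\tau\mathbb{Z}$ would give
$2z \in \mathbb{Z} + \mathbb{Z}\tau$.\<close>

lemma generic_point_off_lattice:
  fixes j \<epsilon> :: real and \<tau> z :: complex
  assumes z: "generic_point \<tau> z" and j: "2 * j = of_int a" and \<epsilon>: "2 * \<epsilon> = of_int b"
  shows "off_lattice (of_int M * \<tau>) (z + j * \<tau> + \<epsilon>)"
  unfolding off_lattice_def
proof (intro allI notI)
  fix n :: int
  assume "exp (2 * pi * \<i> * (z + j * \<tau> + \<epsilon>)) * qpow (of_int M * \<tau>) (of_int n) = 1"
  then have "exp (2 * pi * \<i> * (z + j * \<tau> + \<epsilon> + of_int (M * n) * \<tau>)) = exp 0"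
    by (simp add: qpow_def exp_add [symmetric] algebra_simps)
  then obtain N where "2 * pi * \<i> * (z + j * \<tau> + \<epsilon> + of_int (M * n) * \<tau>) = 0 + (of_int (2 * N) * pi) * \<i>"
    unfolding exp_eq by blast
  then have "2 * pi * \<i> * (z + j * \<tau> + \<epsilon> + of_int (M * n) * \<tau>) = 2 * pi * \<i> * of_int N"
    by (simp add: algebra_simps)
  then have "z + j * \<tau> + \<epsilon> + of_int (M * n) * \<tau> = of_int N"
    by (subst (asm) mult_left_cancel) auto
  moreover have "2 * (z + j * \<tau> + \<epsilon> + of_int (M * n) * \<tau>)
      = 2 * z + of_real (2 * j) * \<tau> + of_real (2 * \<epsilon>) + 2 * of_int (M * n) * \<tau>"
    by (simp add: algebra_simps)
  ultimately have "2 * z = of_int (2 * N - b) + of_int (- a - 2 * M * n) * \<tau>"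
    unfolding j \<epsilon> by (simp add: algebra_simps)
  with z show False unfolding generic_point_def by blast
qed

section \<open>The modified numerators\<close>

lemma numer_I_eq:
  "numer_I m M m2 k1 k2 \<tau> z1 z2 t
    = phase m M (t + (of_int (k1 + k2) * z1 - of_int k1 * z2) + of_int k1 * of_int (k1 + k2) * \<tau>)
      * D0_minus m2 (Phit (- m) (of_int M * \<tau>)) (z1 + of_int k1 * \<tau>) (z2 - of_int (k1 + k2) * \<tau>)"
proof -
  have "qpow \<tau> (of_int m / of_int M * of_int k1 * of_int (k1 + k2)) = phase m M (of_int k1 * of_int (k1 + k2) * \<tau>)"
    unfolding phase_def qpow_def by (rule arg_cong [where f = exp]) (simp add: mult_ac)
  then show ?thesis
    unfolding numer_I_def Let_def D0_minus_def phase_def [symmetric] by (simp only: phase_add mult.assoc)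
qed

text \<open>The sign $-(-1)^{m_2}$ for characters, written as the exponential that arises from
$-e^{\pi i(\Lambda|\alpha_2)}$.\<close>

definition char_sign :: "real \<Rightarrow> int \<Rightarrow> complex" where
  "char_sign \<epsilon> m2 = (if \<epsilon> = 0 then 1 else - exp (- (pi * \<i> * of_int m2)))"

lemma char_sign_cases: "char_sign \<epsilon> m2 \<in> {1, -1}"
proof -
  have "exp (- (pi * \<i> * of_int m2)) ^ 2 = 1"
  proof -
    have "exp (- (pi * \<i> * of_int m2)) ^ 2 = exp (2 * pi * \<i> * (0 + of_int (- m2)))"
      by (simp add: exp_double [symmetric] algebra_simps)
    also have "\<dots> = 1" unfolding exp_period by simp
    finally show ?thesis .
  qed
  then show ?thesis by (auto simp: char_sign_def power2_eq_1_iff)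
qed

text \<open>The factor $e^{\pi i(\Lambda|\alpha_2)}$ in the definition of $N^+$ is there to absorb the phase $e^{\pm\pi i K k_2}$ produced by the
shift of $z_1, z_2$ by $\frac12$; only a sign is left.\<close>

lemma exp_wform_I:
  assumes "M > 0"
  shows "- exp (pi * \<i> * wform (Lam_adm m M m2 Type_I k1 k2) alpha2) * phase m M (of_int k2 / 2) = char_sign (1/2) m2"
proof -
  have "exp (pi * \<i> * wform (Lam_adm m M m2 Type_I k1 k2) alpha2) * phase m M (of_int k2 / 2)
      = exp (- (pi * \<i> * of_int m2))"
    unfolding Lam_adm_alpha2 [OF assms] phase_def exp_add [symmetric]
    by (rule arg_cong [where f = exp]) (simp add: algebra_simps)
  then show ?thesis by (simp add: char_sign_def)
qed

lemma exp_wform_III: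
  assumes "M > 0"
  shows "- exp (pi * \<i> * wform (Lam_adm m M m2 Type_III k1 k2) alpha2) * phase m M (- (of_int k2 / 2)) = char_sign (1/2) m2"
proof -
  have "exp (pi * \<i> * wform (Lam_adm m M m2 Type_III k1 k2) alpha2) * phase m M (- (of_int k2 / 2))
      = exp (2 * pi * \<i> * (- (of_int m2 / 2) + of_int (m2 + 1)))"
    unfolding Lam_adm_alpha2 [OF assms]
    by (simp add: phase_def exp_add [symmetric] algebra_simps)
  also have "\<dots> = exp (- (pi * \<i> * of_int m2))" unfolding exp_period by (simp add: mult.assoc)
  finally show ?thesis by (simp add: char_sign_def)
qed

text \<open>Both numerators $N^\pm$ in a single formula, with the shift by $\frac12$ expressed as a shift by $\epsilon$.\<close>

lemma numer_Type_I:
  fixes \<epsilon> :: real and \<tau> z1 z2 t :: complex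
  assumes "M > 0" and \<epsilon>: "\<epsilon> \<in> {0, 1/2}"
  shows "numer \<epsilon> m M m2 Type_I k1 k2 \<tau> z1 z2 t = char_sign \<epsilon> m2
      * phase m M (t + (of_int (k1 + k2) * z1 - of_int k1 * z2) + of_int k1 * of_int (k1 + k2) * \<tau>)
      * D0_minus m2 (Phit (- m) (of_int M * \<tau>)) (z1 + \<epsilon> + of_int k1 * \<tau>) (z2 + \<epsilon> - of_int (k1 + k2) * \<tau>)"
proof (cases "\<epsilon> = 0")
  case True
  then show ?thesis by (simp add: numer_def char_sign_def numer_I_eq)
next
  case False
  with \<epsilon> have half: "\<epsilon> = 1/2" by simp
  have ph: "t + (of_int (k1 + k2) * (z1 + 1/2) - of_int k1 * (z2 + 1/2)) + of_int k1 * of_int (k1 + k2) * \<tau>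
      = of_int k2 / 2 + (t + (of_int (k1 + k2) * z1 - of_int k1 * z2) + of_int k1 * of_int (k1 + k2) * \<tau>)"
    by (simp add: field_simps)
  have "numer \<epsilon> m M m2 Type_I k1 k2 \<tau> z1 z2 t
      = - exp (pi * \<i> * wform (Lam_adm m M m2 Type_I k1 k2) alpha2) * numer_I m M m2 k1 k2 \<tau> (z1 + 1/2) (z2 + 1/2) t"
    using False by (simp only: numer_def numer_plus_def if_False numer_minus.simps)
  also have "\<dots>
      = (- exp (pi * \<i> * wform (Lam_adm m M m2 Type_I k1 k2) alpha2) * phase m M (of_int k2 / 2))
      * phase m M (t + (of_int (k1 + k2) * z1 - of_int k1 * z2) + of_int k1 * of_int (k1 + k2) * \<tau>)
      * D0_minus m2 (Phit (- m) (of_int M * \<tau>)) (z1 + 1/2 + of_int k1 * \<tau>) (z2 + 1/2 - of_int (k1 + k2) * \<tau>)"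
    unfolding numer_I_eq ph phase_add [of m M "of_int k2 / 2"] by (simp only: mult.assoc)
  finally show ?thesis
    unfolding exp_wform_I [OF assms(1)] half by (simp add: algebra_simps)
qed

lemma numer_Type_III:
  fixes \<epsilon> :: real and \<tau> z1 z2 t :: complex
  assumes "M > 0" and \<epsilon>: "\<epsilon> \<in> {0, 1/2}"
  shows "numer \<epsilon> m M m2 Type_III k1 k2 \<tau> z1 z2 t = char_sign \<epsilon> m2
      * phase m M (t + (of_int k1 * z1 - of_int (k1 + k2) * z2) + of_int k1 * of_int (k1 + k2) * \<tau>)
      * D0_minus m2 (Phit (- m) (of_int M * \<tau>)) (- z2 - \<epsilon> + of_int k1 * \<tau>) (- z1 - \<epsilon> - of_int (k1 + k2) * \<tau>)"
proof (cases "\<epsilon> = 0")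
  case True
  then show ?thesis by (simp add: numer_def char_sign_def numer_I_eq algebra_simps)
next
  case False
  with \<epsilon> have half: "\<epsilon> = 1/2" by simp
  have ph: "t + (of_int (k1 + k2) * - (z2 + 1/2) - of_int k1 * - (z1 + 1/2)) + of_int k1 * of_int (k1 + k2) * \<tau>
      = - (of_int k2 / 2) + (t + (of_int k1 * z1 - of_int (k1 + k2) * z2) + of_int k1 * of_int (k1 + k2) * \<tau>)"
    by (simp add: field_simps)
  have "numer \<epsilon> m M m2 Type_III k1 k2 \<tau> z1 z2 t
      = - exp (pi * \<i> * wform (Lam_adm m M m2 Type_III k1 k2) alpha2) * numer_I m M m2 k1 k2 \<tau> (- (z2 + 1/2)) (- (z1 + 1/2)) t"
    using False by (simp only: numer_def numer_plus_def if_False numer_minus.simps)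
  also have "\<dots>
      = (- exp (pi * \<i> * wform (Lam_adm m M m2 Type_III k1 k2) alpha2) * phase m M (- (of_int k2 / 2)))
      * phase m M (t + (of_int k1 * z1 - of_int (k1 + k2) * z2) + of_int k1 * of_int (k1 + k2) * \<tau>)
      * D0_minus m2 (Phit (- m) (of_int M * \<tau>)) (- (z2 + 1/2) + of_int k1 * \<tau>) (- (z1 + 1/2) - of_int (k1 + k2) * \<tau>)"
    unfolding numer_I_eq ph phase_add [of m M "- (of_int k2 / 2)"] by (simp only: mult.assoc)
  finally show ?thesis
    unfolding exp_wform_III [OF assms(1)] half by (simp add: algebra_simps)
qed

section \<open>The character formulas\<close>

theorem theorem9p6:
  fixes m M m2 k1 k2 :: int and J :: adm_type and \<epsilon> j k j' k' :: real
  assumes "m < 0" and "M > 0" and "0 \<le> m2" and "m2 \<le> - m"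
    and "adm_range J M k1 k2"
    and "\<epsilon> \<in> {0, 1/2}"
    and "(j, k) = (case J of
           Type_I \<Rightarrow> (of_int k1 + 1/2, - of_int k1 - of_int k2 - 1/2)
         | Type_III \<Rightarrow> (of_int k1 + of_int k2 + 1/2, - of_int k1 - 1/2))"
    and "(j', k') = (case J of
           Type_I \<Rightarrow> (of_int k1 + of_int k2 + 1, - of_int k1)
         | Type_III \<Rightarrow> (of_int k1 + 1, - of_int k1 - of_int k2))"
  shows "(\<exists>s\<in>{1, -1 :: complex}. \<forall>\<tau> z. Im \<tau> > 0 \<and> generic_point \<tau> z \<longrightarrow>
            ch_H \<epsilon> m M m2 J k1 k2 \<tau> z =
              s * (chi1 M m \<epsilon> (1/2) j k \<tau> z
                   - (of_int m * (j - k) / of_int M + of_int m2) * chi0 M m \<epsilon> (1/2) j k \<tau> z))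
       \<and> (\<exists>s\<in>{1, -1 :: complex}. \<forall>\<tau> z. Im \<tau> > 0 \<and> generic_point \<tau> z \<longrightarrow>
            ch_Htw \<epsilon> m M m2 J k1 k2 \<tau> z =
              s * (chi1 M m \<epsilon> 0 j' k' \<tau> z
                   - (of_int m * (j' - k') / of_int M + of_int m2) * chi0 M m \<epsilon> 0 j' k' \<tau> z))"
proof -
  let ?\<sigma> = "char_sign \<epsilon> m2"
  let ?G = "\<lambda>\<tau>. D0_minus m2 (Phit (- m) (of_int M * \<tau>))"
  have sign: "?\<sigma> \<in> {1, -1}" "- ?\<sigma> \<in> {1, -1}"
    using char_sign_cases [of \<epsilon> m2] by auto
  obtain b :: int where b: "2 * \<epsilon> = of_int b"
    using assms(6) by (metis (no_types) insertE mult_zero_right nonzero_mult_div_cancel_left of_int_0 of_int_1 singletonD times_divide_eq_right zero_neq_numeral mult.right_neutral)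
  have half_int: "\<exists>a::int. 2 * x = of_int a" if "x \<in> {j, k, j', k'}" for x
  proof (cases J)
    case Type_I
    then have "2 * x \<in> {of_int (2 * k1 + 1), of_int (- 2 * k1 - 2 * k2 - 1), of_int (2 * k1 + 2 * k2 + 2), of_int (- 2 * k1)}"
      using that assms(7,8) by auto
    then show ?thesis by blast
  next
    case Type_III
    then have "2 * x \<in> {of_int (2 * k1 + 2 * k2 + 1), of_int (- 2 * k1 - 1), of_int (2 * k1 + 2), of_int (- 2 * k1 - 2 * k2)}"
      using that assms(7,8) by auto
    then show ?thesis by blast
  qed
  have off: "off_lattice (of_int M * \<tau>) (z + x * \<tau> + \<epsilon>)" if "x \<in> {j, k, j', k'}" "generic_point \<tau> z" for x :: real and \<tau> z :: complex
    using half_int [OF that(1)] generic_point_off_lattice [OF that(2) _ b] by blast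
  have rhs: "s * (chi1 M m \<epsilon> \<epsilon>' x y \<tau> z - (of_int m * (x - y) / of_int M + of_int m2) * chi0 M m \<epsilon> \<epsilon>' x y \<tau> z)
      = s * phase m M (- (x * y * \<tau> + (x + y) * z)) * ?G \<tau> (z + x * \<tau> + \<epsilon>) (z + y * \<tau> + \<epsilon>) / Rden \<epsilon> \<epsilon>' \<tau> z"
    if "x \<in> {j, k, j', k'}" "y \<in> {j, k, j', k'}" "Im \<tau> > 0" "generic_point \<tau> z" for s \<tau> z :: complex and \<epsilon>' x y :: real
    unfolding chi_combination [OF assms(1,2) that(3) off [OF that(1,4)] off [OF that(2,4)]] by simp
  have antisym: "?G \<tau> (- (z + y * \<tau> + \<epsilon>)) (- (z + x * \<tau> + \<epsilon>)) = - ?G \<tau> (z + x * \<tau> + \<epsilon>) (z + y * \<tau> + \<epsilon>)"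
    if "x \<in> {j, k, j', k'}" "y \<in> {j, k, j', k'}" "Im \<tau> > 0" "generic_point \<tau> z" for x y :: real and \<tau> z :: complex
    by (rule D0_minus_Phit_antisym) (use assms(1,2) that off in auto)
  have shift: "?G \<tau> (w1 + 2 * \<epsilon>) (w2 + 2 * \<epsilon>) = ?G \<tau> w1 w2" for \<tau> w1 w2 :: complex
    by (rule D0_minus_Phit_shift_twice) (use assms(1,6) in auto)
  show ?thesis
  proof (cases J)
    case Type_I
    then have jk: "j = of_int k1 + 1/2" "k = - of_int k1 - of_int k2 - 1/2"
      "j' = of_int k1 + of_int k2 + 1" "k' = - of_int k1"
      using assms(7,8) by auto
    have H: "ch_H \<epsilon> m M m2 J k1 k2 \<tau> z = ?\<sigma> * (chi1 M m \<epsilon> (1/2) j k \<tau> z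
        - (of_int m * (j - k) / of_int M + of_int m2) * chi0 M m \<epsilon> (1/2) j k \<tau> z)"
      if "Im \<tau> > 0" "generic_point \<tau> z" for \<tau> z :: complex
    proof -
      have 1: "\<tau> / 4 + (of_int (k1 + k2) * (z + \<tau> / 2) - of_int k1 * (z - \<tau> / 2)) + of_int k1 * of_int (k1 + k2) * \<tau>
          = - (j * k * \<tau> + (j + k) * z)"
        by (simp add: jk field_simps)
      have 2: "z + \<tau> / 2 + \<epsilon> + of_int k1 * \<tau> = z + j * \<tau> + \<epsilon>" "z - \<tau> / 2 + \<epsilon> - of_int (k1 + k2) * \<tau> = z + k * \<tau> + \<epsilon>"
        by (simp_all add: jk algebra_simps)
      show ?thesis
        unfolding ch_H_def Type_I numer_Type_I [OF assms(2,6)] 1 2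
        by (rule rhs [symmetric]) (use that in auto)
    qed
    have Htw: "ch_Htw \<epsilon> m M m2 J k1 k2 \<tau> z = - ?\<sigma> * (chi1 M m \<epsilon> 0 j' k' \<tau> z
        - (of_int m * (j' - k') / of_int M + of_int m2) * chi0 M m \<epsilon> 0 j' k' \<tau> z)"
      if "Im \<tau> > 0" "generic_point \<tau> z" for \<tau> z :: complex
    proof -
      have 1: "\<tau> / 4 - (z + \<tau> / 2 + (z - \<tau> / 2)) / 2 - \<tau> / 4
            + (of_int (k1 + k2) * (- (z - \<tau> / 2) - \<tau> / 2) - of_int k1 * (- (z + \<tau> / 2) - \<tau> / 2)) + of_int k1 * of_int (k1 + k2) * \<tau>
          = - (j' * k' * \<tau> + (j' + k') * z)"
        by (simp add: jk field_simps)
      \<comment> \<open>The twist reverses \<open>z\<close> but not the shift by \<open>\<epsilon>\<close>; the discrepancy \<open>2 * \<epsilon>\<close> is 0 or 1, a period.\<close>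
      have 2: "- (z - \<tau> / 2) - \<tau> / 2 + \<epsilon> + of_int k1 * \<tau> = - (z + k' * \<tau> + \<epsilon>) + 2 * \<epsilon>"
        "- (z + \<tau> / 2) - \<tau> / 2 + \<epsilon> - of_int (k1 + k2) * \<tau> = - (z + j' * \<tau> + \<epsilon>) + 2 * \<epsilon>"
        by (simp_all add: jk field_simps)
      have 3: "?G \<tau> (- (z + k' * \<tau> + \<epsilon>)) (- (z + j' * \<tau> + \<epsilon>)) = - ?G \<tau> (z + j' * \<tau> + \<epsilon>) (z + k' * \<tau> + \<epsilon>)"
        by (rule antisym) (use that in auto)
      show ?thesis
        unfolding ch_Htw_def numer_tw_def Type_I numer_Type_I [OF assms(2,6)] 1 2 shift 3
        by (subst rhs) (use that in auto)
    qed
    show ?thesis using sign H Htw by blast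
  next
    case Type_III
    then have jk: "j = of_int k1 + of_int k2 + 1/2" "k = - of_int k1 - 1/2"
      "j' = of_int k1 + 1" "k' = - of_int k1 - of_int k2"
      using assms(7,8) by auto
    have H: "ch_H \<epsilon> m M m2 J k1 k2 \<tau> z = - ?\<sigma> * (chi1 M m \<epsilon> (1/2) j k \<tau> z
        - (of_int m * (j - k) / of_int M + of_int m2) * chi0 M m \<epsilon> (1/2) j k \<tau> z)"
      if "Im \<tau> > 0" "generic_point \<tau> z" for \<tau> z :: complex
    proof -
      have 1: "\<tau> / 4 + (of_int k1 * (z + \<tau> / 2) - of_int (k1 + k2) * (z - \<tau> / 2)) + of_int k1 * of_int (k1 + k2) * \<tau>
          = - (j * k * \<tau> + (j + k) * z)"
        by (simp add: jk field_simps)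
      \<comment> \<open>Here both arguments are reversed and exchanged, which costs a sign.\<close>
      have 2: "- (z - \<tau> / 2) - \<epsilon> + of_int k1 * \<tau> = - (z + k * \<tau> + \<epsilon>)"
        "- (z + \<tau> / 2) - \<epsilon> - of_int (k1 + k2) * \<tau> = - (z + j * \<tau> + \<epsilon>)"
        by (simp_all add: jk field_simps)
      have 3: "?G \<tau> (- (z + k * \<tau> + \<epsilon>)) (- (z + j * \<tau> + \<epsilon>)) = - ?G \<tau> (z + j * \<tau> + \<epsilon>) (z + k * \<tau> + \<epsilon>)"
        by (rule antisym) (use that in auto)
      show ?thesis
        unfolding ch_H_def Type_III numer_Type_III [OF assms(2,6)] 1 2 3
        by (subst rhs) (use that in auto)
    qed
    have Htw: "ch_Htw \<epsilon> m M m2 J k1 k2 \<tau> z = ?\<sigma> * (chi1 M m \<epsilon> 0 j' k' \<tau> z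
        - (of_int m * (j' - k') / of_int M + of_int m2) * chi0 M m \<epsilon> 0 j' k' \<tau> z)"
      if "Im \<tau> > 0" "generic_point \<tau> z" for \<tau> z :: complex
    proof -
      have 1: "\<tau> / 4 - (z + \<tau> / 2 + (z - \<tau> / 2)) / 2 - \<tau> / 4
            + (of_int k1 * (- (z - \<tau> / 2) - \<tau> / 2) - of_int (k1 + k2) * (- (z + \<tau> / 2) - \<tau> / 2)) + of_int k1 * of_int (k1 + k2) * \<tau>
          = - (j' * k' * \<tau> + (j' + k') * z)"
        by (simp add: jk field_simps)
      \<comment> \<open>The reversals in the twist and in the passage from type I to type III cancel; the shift by \<open>\<epsilon>\<close> has
        changed sign, again by the period \<open>2 * \<epsilon>\<close>.\<close>
      have 2: "z + j' * \<tau> + \<epsilon> = - (- (z + \<tau> / 2) - \<tau> / 2) - \<epsilon> + of_int k1 * \<tau> + 2 * \<epsilon>"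
        "z + k' * \<tau> + \<epsilon> = - (- (z - \<tau> / 2) - \<tau> / 2) - \<epsilon> - of_int (k1 + k2) * \<tau> + 2 * \<epsilon>"
        by (simp_all add: jk field_simps)
      have 3: "?G \<tau> (- (- (z + \<tau> / 2) - \<tau> / 2) - \<epsilon> + of_int k1 * \<tau>) (- (- (z - \<tau> / 2) - \<tau> / 2) - \<epsilon> - of_int (k1 + k2) * \<tau>)
          = ?G \<tau> (z + j' * \<tau> + \<epsilon>) (z + k' * \<tau> + \<epsilon>)"
        unfolding 2 shift ..
      show ?thesis
        unfolding ch_Htw_def numer_tw_def Type_III numer_Type_III [OF assms(2,6)] 1 3
        by (rule rhs [symmetric]) (use that in auto)
    qed
    show ?thesis using sign H Htw by blast
  qed
qed

end
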